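(* Suppose $pn\to\infty$ and $q\ln n\to\infty$ as $n\to\infty$, where $q=1-p$. Then for every $\varepsilon>0$ there exists $n_0$ such that for all $n\ge n_0$, $$u_3(n,p)\le(2+\varepsilon)\log_{\frac{1}{1-p}}(np)\quad\text{and}\quad u_3'(n,p)\le(2+\varepsilon)\log_{\frac{1}{1-p}}(np).$$
   Context: $G(n,p)$ is the Erdős–Rényi random graph on $n$ labelled vertices (vertex set $V$), each edge present independently with probability $p=p(n)$; $\mathbb{P}_{n,p}$ is the corresponding probability and $q=1-p$. A diameter graph in $\mathbb{R}^d$ is a graph $(V,E)$ with $V\subset\mathbb{R}^d$ finite and $E=\{\{\mathbf{x},\mathbf{y}\}\subseteq V: |\mathbf{x}-\mathbf{y}|=\operatorname{diam}V\}$, where $\operatorname{diam}V=\max_{\mathbf{x},\mathbf{y}\in V}|\mathbf{x}-\mathbf{y}|$ (Euclidean norm); a graph is a diameter graph in $\mathbb{R}^d$ if it is isomorphic to one. $u_d(n,p)$ is the largest positive integer $k$ such that $\mathbb{P}_{n,p}\big(\exists W\subseteq V,\ |W|=k,\ G[W]$ is a diameter graph in $\mathbb{R}^d$ and $\chi(G[W])=d+1\big)>\frac12$, where $G[W]$ is the induced subgraph; if no such $k$ exists, $u_d(n,p)=0$. $u_d'(n,p)$ is defined identically with the additional requirement that $G[W]$ be connected. *)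

theory Defs
  imports "HOL-Analysis.Analysis"
begin

text \<open>The random graph G(n,p) on vertex set {0..<n}: a graph is given by its edge set,
a set of 2-element subsets of {0..<n}.\<close>

definition all_pairs :: "nat \<Rightarrow> nat set set" where
  "all_pairs n = {e. \<exists>i j. i < j \<and> j < n \<and> e = {i, j}}"

text \<open>Probability of a graph property Q in G(n,p), each edge independently with probability p.\<close>
definition prob_gnp :: "nat \<Rightarrow> real \<Rightarrow> (nat set set \<Rightarrow> bool) \<Rightarrow> real" where
  "prob_gnp n p Q =
     (\<Sum>E\<in>Pow (all_pairs n).
        (if Q E then p ^ card E * (1 - p) ^ (card (all_pairs n) - card E) else 0))"

text \<open>The induced subgraph G[W] (edge set E, vertex subset W) is a diameter graph in the
Euclidean space 'a: it is isomorphic to the diameter graph of some finite point set.\<close>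
definition is_diameter_graph :: "'a::euclidean_space itself \<Rightarrow> nat set \<Rightarrow> nat set set \<Rightarrow> bool" where
  "is_diameter_graph _ W E \<longleftrightarrow>
     (\<exists>f :: nat \<Rightarrow> 'a. inj_on f W \<and>
        (\<forall>u\<in>W. \<forall>v\<in>W. u \<noteq> v \<longrightarrow>
           ({u, v} \<in> E \<longleftrightarrow> dist (f u) (f v) = diameter (f ` W))))"

text \<open>Chromatic number of the induced subgraph G[W].\<close>
definition chromatic_number :: "nat set \<Rightarrow> nat set set \<Rightarrow> nat" where
  "chromatic_number W E =
     (LEAST k. \<exists>c :: nat \<Rightarrow> nat. (\<forall>v\<in>W. c v < k) \<and>
        (\<forall>u\<in>W. \<forall>v\<in>W. u \<noteq> v \<and> {u, v} \<in> E \<longrightarrow> c u \<noteq> c v))"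

text \<open>The induced subgraph G[W] is connected.\<close>
definition induced_connected :: "nat set \<Rightarrow> nat set set \<Rightarrow> bool" where
  "induced_connected W E \<longleftrightarrow>
     (\<forall>u\<in>W. \<forall>v\<in>W. (u, v) \<in> {(x, y). x \<in> W \<and> y \<in> W \<and> {x, y} \<in> E}\<^sup>*)"

definition good_set :: "'a::euclidean_space itself \<Rightarrow> bool \<Rightarrow> nat \<Rightarrow> nat \<Rightarrow> nat set set \<Rightarrow> bool" where
  "good_set T conn n k E \<longleftrightarrow>
     (\<exists>W. W \<subseteq> {0..<n} \<and> card W = k \<and> is_diameter_graph T W E
          \<and> chromatic_number W E = DIM('a) + 1
          \<and> (conn \<longrightarrow> induced_connected W E))"

text \<open>u_d(n,p) (conn = False) and u_d'(n,p) (conn = True), with d = DIM('a).\<close>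
definition u_gen :: "'a::euclidean_space itself \<Rightarrow> bool \<Rightarrow> nat \<Rightarrow> real \<Rightarrow> nat" where
  "u_gen T conn n p =
     (if \<exists>k. 0 < k \<and> prob_gnp n p (good_set T conn n k) > 1/2
      then (GREATEST k. 0 < k \<and> prob_gnp n p (good_set T conn n k) > 1/2)
      else 0)"

definition u3 :: "nat \<Rightarrow> real \<Rightarrow> nat" where
  "u3 n p = u_gen TYPE(real^3) False n p"

definition u3' :: "nat \<Rightarrow> real \<Rightarrow> nat" where
  "u3' n p = u_gen TYPE(real^3) True n p"

end

theory Submission
  imports Defs "HOL-Real_Asymp.Real_Asymp"
begin

text \<open>
  A diameter graph in \<open>\<real>\<^sup>3\<close> on \<open>k\<close> vertices has only \<open>O(k)\<close> edges. Given this, a first moment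
  computation suffices: a fixed \<open>k\<close>-set spans at most \<open>O(k)\<close> edges with probability about
  \<open>(C p k / q)\<^bsup>O(k)\<^esup> q\<^bsup>k(k-1)/2\<^esup>\<close>, and the factors \<open>p k\<close> and \<open>1/q\<close> are only polylogarithmic in \<open>n p\<close>,
  so the union bound over all \<open>k\<close>-sets is dominated by \<open>(n p q\<^bsup>k/2\<^esup>)\<^bsup>k\<^esup>\<close>.

  For the edge bound, scale the diameter to \<open>1\<close>, orient the edges by a generic linear functional, and
  project their directions centrally to a plane. The directions leaving a vertex \<open>x\<close> span a red convex
  polygon, those entering \<open>y\<close> a blue one. Polygons of equal colour are disjoint, and a red and a blue
  polygon meet, if at all, in the single point of the edge \<open>(x, y)\<close>, where they do not cross. Instead of
  Euler's formula, the contacts are counted by a sweep: a contact is charged to the nearest polygon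
  endpoint to its left that lies between the two touching polygons, and every endpoint is charged boundedly often.
\<close>

section \<open>Sweep count of touching curves\<close>

text \<open>Only two values can occur among the counted elements: \<open>h\<close> itself and the
  largest value below \<open>h\<close>. This bounds how many curves are vertically next to a given
  endpoint.\<close>

lemma card_maximal_below:
  fixes g :: "'i \<Rightarrow> real"
  assumes fin: "finite J" and two: "\<And>v. card {i\<in>J. g i = v} \<le> 2"
  shows "card {i\<in>J. g i \<le> h \<and> (\<forall>m\<in>J. g m < h \<longrightarrow> g m \<le> g i)} \<le> 4"
proof -
  let ?L = "{i\<in>J. g i \<le> h \<and> (\<forall>m\<in>J. g m < h \<longrightarrow> g m \<le> g i)}"
  obtain v where "?L \<subseteq> {i\<in>J. g i = h} \<union> {i\<in>J. g i = v}"
  proof (cases "\<exists>i\<in>?L. g i < h")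
    case True
    then obtain i where i: "i \<in> ?L" "g i < h" by blast
    have "?L \<subseteq> {i\<in>J. g i = h} \<union> {j\<in>J. g j = g i}"
      using i by (auto intro: antisym simp: not_less order.order_iff_strict)
    then show ?thesis by (rule that)
  next
    case False
    then have "?L \<subseteq> {i\<in>J. g i = h} \<union> {j\<in>J. g j = 0}" by force
    then show ?thesis by (rule that)
  qed
  then have "card ?L \<le> card ({i\<in>J. g i = h} \<union> {i\<in>J. g i = v})"
    using fin by (intro card_mono) auto
  also have "\<dots> \<le> card {i\<in>J. g i = h} + card {i\<in>J. g i = v}" by (rule card_Un_le)
  also have "\<dots> \<le> 4" using two[of h] two[of v] by linarith
  finally show ?thesis .
qed

text \<open>The lower curve of a touching pair is next below the charged endpoint and the upper one
  next above, so an endpoint is charged by at most \<open>4 * 4\<close> pairs. There are at most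
  \<open>2 * card I\<close> endpoints, and either curve may be the lower one, hence 64.\<close>

lemma touching_pairs_bound:
  fixes l r :: "'i \<Rightarrow> real" and \<phi> :: "'i \<Rightarrow> real \<Rightarrow> real"
  assumes fin: "finite I"
    and cons: "\<And>i j. i \<in> I \<Longrightarrow> j \<in> I \<Longrightarrow> i \<noteq> j \<Longrightarrow>
        (\<forall>t\<in>{l i..r i} \<inter> {l j..r j}. \<phi> i t \<le> \<phi> j t) \<or>
        (\<forall>t\<in>{l i..r i} \<inter> {l j..r j}. \<phi> j t \<le> \<phi> i t)"
    and two: "\<And>t v. card {i\<in>I. t \<in> {l i..r i} \<and> \<phi> i t = v} \<le> 2"
    and ends: "\<And>i j t. i \<in> I \<Longrightarrow> j \<in> I \<Longrightarrow> t \<in> {l i, r i} \<Longrightarrow> t \<in> {l j, r j} \<Longrightarrow> \<phi> i t = \<phi> j t"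
  shows "card {(i,j). i \<in> I \<and> j \<in> I \<and> i \<noteq> j \<and>
           (\<exists>t. l i < t \<and> t \<le> r i \<and> l j < t \<and> t \<le> r j \<and> \<phi> i t = \<phi> j t)} \<le> 64 * card I"
    (is "card ?M \<le> _")
proof -
  define D where "D i = {l i..r i}" for i
  define E where "E = Sigma I (\<lambda>k. {l k, r k})"
  \<comment> \<open>\<open>Lo\<close> and \<open>Up\<close> collect the curves level with the
    endpoint or next below it, respectively next above it. \<open>Up\<close> negates heights so that
    one counting lemma serves both.\<close>
  define Lo where "Lo = (\<lambda>(k,\<tau>). {i\<in>{i\<in>I. \<tau> \<in> D i}. \<phi> i \<tau> \<le> \<phi> k \<tau> \<and>
      (\<forall>m\<in>{i\<in>I. \<tau> \<in> D i}. \<phi> m \<tau> < \<phi> k \<tau> \<longrightarrow> \<phi> m \<tau> \<le> \<phi> i \<tau>)})"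
  define Up where "Up = (\<lambda>(k,\<tau>). {i\<in>{i\<in>I. \<tau> \<in> D i}. - \<phi> i \<tau> \<le> - \<phi> k \<tau> \<and>
      (\<forall>m\<in>{i\<in>I. \<tau> \<in> D i}. - \<phi> m \<tau> < - \<phi> k \<tau> \<longrightarrow> - \<phi> m \<tau> \<le> - \<phi> i \<tau>)})"
  have finE: "finite E" unfolding E_def using fin by auto
  have cardE: "card E \<le> 2 * card I"
  proof -
    have "card E = (\<Sum>k\<in>I. card {l k, r k})" unfolding E_def using fin by simp
    also have "\<dots> \<le> (\<Sum>k\<in>I. 2)" by (intro sum_mono) (simp add: card_insert_if)
    finally show ?thesis by simp
  qed
  have two': "card {i\<in>{i\<in>I. \<tau> \<in> D i}. \<phi> i \<tau> = v} \<le> 2" for \<tau> v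
    using two[of \<tau> v] unfolding D_def by (simp add: conj_assoc)
  have cLo: "card (Lo e) \<le> 4" for e
    unfolding Lo_def by (cases e, simp only: prod.case, rule card_maximal_below) (use fin two' in auto)
  have two'': "card {i\<in>{i\<in>I. \<tau> \<in> D i}. - \<phi> i \<tau> = v} \<le> 2" for \<tau> v
    using two'[of \<tau> "-v"] by (simp add: minus_equation_iff eq_commute[of _ "- v"] eq_commute[of v])
  have cUp: "card (Up e) \<le> 4" for e
    unfolding Up_def by (cases e, simp only: prod.case, rule card_maximal_below) (use fin two'' in auto)
  define N where "N = (\<Union>e\<in>E. Lo e \<times> Up e)"
  have finN: "finite N" unfolding N_def Lo_def Up_def using finE fin by (auto split: prod.splits)
  have cardN: "card N \<le> 32 * card I"
  proof -
    have "card N \<le> (\<Sum>e\<in>E. card (Lo e \<times> Up e))" unfolding N_def by (rule card_UN_le[OF finE])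
    also have "\<dots> \<le> (\<Sum>e\<in>E. 4 * 4)"
      by (intro sum_mono) (use cLo cUp in \<open>simp only: card_cartesian_product mult_le_mono\<close>)
    finally show ?thesis using cardE by simp
  qed
  have key: "(i, j) \<in> N"
    if ij: "i \<in> I" "j \<in> I" "i \<noteq> j" and le: "\<forall>t\<in>D i \<inter> D j. \<phi> i t \<le> \<phi> j t"
      and t: "l i < t" "t \<le> r i" "l j < t" "t \<le> r j" "\<phi> i t = \<phi> j t" for i j t
  proof -
    \<comment> \<open>The touching is charged to the last endpoint before \<open>t\<close> lying between the two curves.\<close>
    define Q where "Q = {(k,\<tau>)\<in>E. \<tau> < t \<and> \<tau> \<in> D i \<and> \<tau> \<in> D j \<and> \<phi> i \<tau> \<le> \<phi> k \<tau> \<and> \<phi> k \<tau> \<le> \<phi> j \<tau>}"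
    have finQ: "finite Q" unfolding Q_def by (rule finite_subset[OF _ finE]) auto
    \<comment> \<open>The later of the two left endpoints qualifies; the strict inequalities
      \<open>l i < t\<close> and \<open>l j < t\<close> put it before \<open>t\<close>.\<close>
    have "Q \<noteq> {}"
    proof (cases "l i \<le> l j")
      case True
      then have "(j, l j) \<in> Q" unfolding Q_def E_def using ij t le by (auto simp: D_def)
      then show ?thesis by auto
    next
      case False
      then have "(i, l i) \<in> Q" unfolding Q_def E_def using ij t le by (auto simp: D_def)
      then show ?thesis by auto
    qed
    then have "Max (snd ` Q) \<in> snd ` Q" using finQ by simp
    then obtain k \<tau> where k: "(k, \<tau>) \<in> Q" "\<tau> = Max (snd ` Q)" by force
    have mx: "\<tau>' \<le> \<tau>" if "(k', \<tau>') \<in> Q" for k' \<tau>'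
      using that finQ k(2) by (metis Max_ge finite_imageI image_eqI snd_conv)
    from k have \<tau>: "k \<in> I" "\<tau> \<in> {l k, r k}" "\<tau> < t" "\<tau> \<in> D i" "\<tau> \<in> D j" "\<phi> i \<tau> \<le> \<phi> k \<tau>" "\<phi> k \<tau> \<le> \<phi> j \<tau>"
      unfolding Q_def E_def by auto
    \<comment> \<open>A curve strictly between the two at \<open>\<tau>\<close> that reached
      \<open>t\<close> would be squeezed through the touching point as a third curve there. So it
      ends before \<open>t\<close>, its right end belongs to \<open>Q\<close>, and maximality puts
      that end at \<open>\<tau>\<close>; then \<open>ends\<close> gives it the height of
      \<open>k\<close>.\<close>
    have none: "\<phi> m \<tau> = \<phi> k \<tau>" if m: "m \<in> I" "\<tau> \<in> D m" and b: "\<phi> i \<tau> < \<phi> m \<tau>" "\<phi> m \<tau> < \<phi> j \<tau>" for m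
    proof -
      have mi: "m \<noteq> i" "m \<noteq> j" using b by auto
      have lo: "\<forall>s\<in>D m \<inter> D i. \<phi> i s \<le> \<phi> m s"
        using cons[OF m(1) ij(1) mi(1)] b(1) m(2) \<tau>(4) unfolding D_def by (meson IntI leD)
      have up: "\<forall>s\<in>D m \<inter> D j. \<phi> m s \<le> \<phi> j s"
        using cons[OF m(1) ij(2) mi(2)] b(2) m(2) \<tau>(5) unfolding D_def by (meson IntI leD)
      have rt: "r m < t"
      proof (rule ccontr)
        assume "\<not> r m < t"
        then have tm: "t \<in> D m" "t \<in> D i" "t \<in> D j" using m(2) \<tau>(3) t by (auto simp: D_def)
        then have "\<phi> m t = \<phi> i t" using lo up t(5) by (metis IntI antisym)
        then have "{m, i, j} \<subseteq> {i'\<in>{i\<in>I. t \<in> D i}. \<phi> i' t = \<phi> i t}" using tm ij m t(5) by auto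
        then have "card {m, i, j} \<le> 2" using fin two'[of t "\<phi> i t"]
          by (intro order_trans[OF card_mono two']) auto
        then show False using mi ij(3) by simp
      qed
      have rin: "\<tau> \<le> r m" "r m \<in> D m" "r m \<in> D i" "r m \<in> D j"
        using m(2) \<tau>(4,5) rt t by (auto simp: D_def)
      have "(m, r m) \<in> Q" unfolding Q_def E_def using m rin rt lo up by auto
      then have "r m = \<tau>" using mx[of m "r m"] rin(1) by linarith
      then show ?thesis using ends[OF m(1) \<tau>(1), of \<tau>] \<tau>(2) by auto
    qed
    have "\<phi> m \<tau> \<le> \<phi> i \<tau>" if "m \<in> I" "\<tau> \<in> D m" "\<phi> m \<tau> < \<phi> k \<tau>" for m
      using none[OF that(1,2)] that(3) \<tau>(7) by linarith
    then have "i \<in> Lo (k, \<tau>)" unfolding Lo_def using \<tau>(4,6) ij(1) by simp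
    moreover have "\<phi> j \<tau> \<le> \<phi> m \<tau>" if "m \<in> I" "\<tau> \<in> D m" "\<phi> k \<tau> < \<phi> m \<tau>" for m
      using none[OF that(1,2)] that(3) \<tau>(6) by linarith
    then have "j \<in> Up (k, \<tau>)" unfolding Up_def using \<tau>(5,7) ij(2) by simp
    moreover have "(k, \<tau>) \<in> E" using k(1) unfolding Q_def by auto
    ultimately show ?thesis unfolding N_def by blast
  qed
  have "?M \<subseteq> N \<union> N\<inverse>"
  proof safe
    fix i j t
    assume *: "i \<in> I" "j \<in> I" "i \<noteq> j" "l i < t" "t \<le> r i" "l j < t" "t \<le> r j" "\<phi> i t = \<phi> j t" "(i, j) \<notin> N"
    then have "\<not> (\<forall>t\<in>D i \<inter> D j. \<phi> i t \<le> \<phi> j t)" using key by blast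
    then have "\<forall>t\<in>D j \<inter> D i. \<phi> j t \<le> \<phi> i t" using cons[OF *(1-3)] unfolding D_def by blast
    then show "(j, i) \<in> N" using key[of j i t] * by auto
  qed
  then have "card ?M \<le> card (N \<union> N\<inverse>)" using finN by (intro card_mono) auto
  also have "\<dots> \<le> card N + card (N\<inverse>)" by (rule card_Un_le)
  also have "\<dots> \<le> 64 * card I" using cardN by simp
  finally show ?thesis .
qed

section \<open>Separation and contacts of polygons in the plane\<close>

text \<open>The hull of \<open>A - {P}\<close> is disjoint from the whole cone with apex
  \<open>P\<close> over the hull of \<open>B\<close>, and a functional bounded above on a cone is
  maximal at the apex. Extremality of \<open>P\<close> on the side of \<open>A\<close> is what
  excludes a crossing at \<open>P\<close>.\<close>

lemma separating_hyperplane_touching_hulls: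
  fixes A B :: "'a::euclidean_space set"
  assumes int: "convex hull A \<inter> convex hull B \<subseteq> {P}" and P: "P \<in> A" "P \<in> B"
    and ext: "P \<notin> convex hull (A - {P})" and ne: "A \<noteq> {P}"
  obtains n c where "n \<noteq> 0" "\<forall>z\<in>convex hull B. n \<bullet> z \<le> c" "\<forall>z\<in>convex hull A. c \<le> n \<bullet> z"
proof -
  let ?T = "convex hull (A - {P})"
  let ?K = "cone hull ((\<lambda>z. - P + z) ` (convex hull B))"
  let ?S = "(\<lambda>z. P + z) ` ?K"
  have TA: "?T \<subseteq> convex hull A" by (rule hull_mono) auto
  have PA: "P \<in> convex hull A" and PB: "P \<in> convex hull B" using P by (auto intro: hull_inc)
  have "convex ?S" by (intro convex_translation convex_cone_hull) auto
  moreover have "convex ?T" by simp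
  moreover have "?T \<noteq> {}" using P ne by auto
  moreover have "?S \<noteq> {}" using PB by (metis cone_hull_empty_iff empty_iff image_is_empty)
  moreover have "?S \<inter> ?T = {}"
  proof (rule ccontr)
    assume "?S \<inter> ?T \<noteq> {}"
    then obtain t z where tz: "t \<ge> 0" "z \<in> convex hull B" "P + t *\<^sub>R (z - P) \<in> ?T"
      by (auto simp: cone_hull_expl)
    show False
    \<comment> \<open>For \<open>t \<le> 1\<close> the point itself lies in the hull of
      \<open>B\<close>; for \<open>t > 1\<close> the point \<open>z\<close>, between it and
      \<open>P\<close>, lies in the hull of \<open>A\<close>. Either way there is a common point of
      the hulls, which must be \<open>P\<close>.\<close>
    proof (cases "t \<le> 1")
      case True
      have "(1 - t) *\<^sub>R P + t *\<^sub>R z \<in> convex hull B"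
        by (intro convexD_alt[OF convex_convex_hull]) (use PB tz True in auto)
      then have "P + t *\<^sub>R (z - P) \<in> convex hull B" by (simp add: algebra_simps)
      then show False using int TA tz(3) ext by auto
    next
      case False
      define y where "y = P + t *\<^sub>R (z - P)"
      have yA: "y \<in> convex hull A" using tz(3) TA y_def by auto
      have "(1 - 1/t) *\<^sub>R P + (1/t) *\<^sub>R y \<in> convex hull A"
        by (intro convexD_alt[OF convex_convex_hull]) (use PA yA False in auto)
      moreover have "(1 - 1/t) *\<^sub>R P + (1/t) *\<^sub>R y = z"
        using False unfolding y_def by (simp add: algebra_simps)
      ultimately have "z = P" using int tz(2) by auto
      then show False using tz(3) ext by simp
    qed
  qed
  ultimately obtain n b where n: "n \<noteq> 0" "\<forall>x\<in>?S. n \<bullet> x \<le> b" "\<forall>x\<in>?T. b \<le> n \<bullet> x"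
    using separating_hyperplane_sets[of ?S ?T] by blast
  have S: "P + t *\<^sub>R (z - P) \<in> ?S" if "t \<ge> 0" "z \<in> convex hull B" for t z
    using that by (force simp: cone_hull_expl)
  have Pb: "n \<bullet> P \<le> b" using n(2) S[of 0 P] PB by auto
  have B: "n \<bullet> z \<le> n \<bullet> P" if z: "z \<in> convex hull B" for z
  proof (rule ccontr)
    assume "\<not> n \<bullet> z \<le> n \<bullet> P"
    then have pos: "n \<bullet> (z - P) > 0" by (simp add: inner_diff_right)
    \<comment> \<open>At this parameter the functional would take the value \<open>b + 1\<close> on
      the ray.\<close>
    define t where "t = (b - n \<bullet> P + 1) / (n \<bullet> (z - P))"
    have "t \<ge> 0" unfolding t_def using pos Pb by auto
    then have "n \<bullet> (P + t *\<^sub>R (z - P)) \<le> b" using n(2) S[OF _ z] by blast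
    then have "n \<bullet> P + t * (n \<bullet> (z - P)) \<le> b" by (simp add: inner_add_right)
    then show False using pos unfolding t_def by (simp add: field_simps)
  qed
  have "A \<subseteq> {z. n \<bullet> P \<le> n \<bullet> z}"
    using n(3) Pb hull_inc[of _ "A - {P}" convex] by force
  moreover have "convex {z. n \<bullet> P \<le> n \<bullet> z}" using convex_halfspace_ge[of "n \<bullet> P" n] by simp
  ultimately have "convex hull A \<subseteq> {z. n \<bullet> P \<le> n \<bullet> z}" by (rule hull_minimal)
  then show ?thesis using that[OF n(1), of "n \<bullet> P"] B by auto
qed

text \<open>A non-vertical separating line leaves one section below the other. A vertical one
  confines \<open>X\<close> to a single abscissa, where one of the comparisons holds
  trivially.\<close>

lemma separated_sections_ordered:
  fixes n :: "real \<times> real"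
  assumes "n \<noteq> 0" "\<forall>z\<in>S. n \<bullet> z \<le> c" "\<forall>z\<in>T. c \<le> n \<bullet> z"
    and "\<And>t. t \<in> X \<Longrightarrow> (t, f t) \<in> S \<and> (t, g t) \<in> T"
  shows "(\<forall>t\<in>X. f t \<le> g t) \<or> (\<forall>t\<in>X. g t \<le> f t)"
proof -
  obtain n1 n2 where n: "n = (n1, n2)" by (cases n)
  have le: "n1 * t + n2 * f t \<le> c" "c \<le> n1 * t + n2 * g t" if "t \<in> X" for t
    using assms(2-4) that unfolding n by (fastforce simp: inner_prod_def)+
  consider "n2 > 0" | "n2 < 0" | "n2 = 0" by linarith
  then show ?thesis
  proof cases
    case 1
    have "f t \<le> g t" if "t \<in> X" for t
    proof -
      have "n2 * f t \<le> n2 * g t" using le[OF that] by linarith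
      then show ?thesis using 1 by simp
    qed
    then show ?thesis by blast
  next
    case 2
    have "g t \<le> f t" if "t \<in> X" for t
    proof -
      have "n2 * f t \<le> n2 * g t" using le[OF that] by linarith
      then show ?thesis using 2 by simp
    qed
    then show ?thesis by blast
  next
    case 3
    then have n1: "n1 \<noteq> 0" using assms(1) n by (auto simp: zero_prod_def)
    have "t = s" if "t \<in> X" "s \<in> X" for t s
    proof -
      have "n1 * t = n1 * s" using le[OF that(1)] le[OF that(2)] 3 by simp
      then show ?thesis using n1 by simp
    qed
    then show ?thesis by (metis linear)
  qed
qed

text \<open>Each polygon is replaced by a height function inside it that passes through its
  generating points, so contacts become touchings of curves, at most 64 per polygon. Contacts at the
  left end of a polygon escape that count, but distinct abscissas allow only one per polygon, hence
  65.\<close>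

lemma contact_edges_bound:
  fixes Ed :: "('x \<times> 'y) set" and pt :: "'x \<times> 'y \<Rightarrow> real \<times> real"
  defines "red \<equiv> \<lambda>x. pt ` {e\<in>Ed. fst e = x}" and "blue \<equiv> \<lambda>y. pt ` {e\<in>Ed. snd e = y}"
  assumes fin: "finite Ed"
    and inj: "inj_on (fst \<circ> pt) Ed"
    and rr: "\<And>x z. x \<noteq> z \<Longrightarrow> convex hull red x \<inter> convex hull red z = {}"
    and bb: "\<And>y w. y \<noteq> w \<Longrightarrow> convex hull blue y \<inter> convex hull blue w = {}"
    and rb: "\<And>x y q. q \<in> convex hull red x \<Longrightarrow> q \<in> convex hull blue y \<Longrightarrow> (x, y) \<in> Ed \<and> q = pt (x, y)"
    and ext: "\<And>x y. (x, y) \<in> Ed \<Longrightarrow> pt (x, y) \<notin> convex hull (red x - {pt (x, y)}) \<or>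
                       pt (x, y) \<notin> convex hull (blue y - {pt (x, y)})"
  shows "card Ed \<le> 65 * (card (fst ` Ed) + card (snd ` Ed))"
proof -
  define I where "I = Inl ` fst ` Ed \<union> Inr ` snd ` Ed"
  define C where "C = case_sum red blue"
  define H where "H i = convex hull C i" for i
  define l where "l i = Min (fst ` C i)" for i
  define r where "r i = Max (fst ` C i)" for i
  \<comment> \<open>Any height in the slice would do for the ordering; preferring a point of
    \<open>C i\<close> makes two sections agree at the abscissa of their contact.\<close>
  define \<phi> where "\<phi> i t = (SOME b. (t, b) \<in> H i \<and> ((\<exists>b'. (t, b') \<in> C i) \<longrightarrow> (t, b) \<in> C i))" for i t
  have finI: "finite I" unfolding I_def using fin by auto
  have cardI: "card I = card (fst ` Ed) + card (snd ` Ed)"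
    unfolding I_def using fin by (subst card_Un_disjoint) (auto simp: card_image)
  have CE: "C i \<subseteq> pt ` Ed" for i unfolding C_def red_def blue_def by (auto split: sum.splits)
  have finC: "finite (C i)" for i using CE fin by (meson finite_imageI finite_subset)
  have Cne: "C i \<noteq> {}" if "i \<in> I" for i using that unfolding I_def C_def red_def blue_def by force
  have CH: "C i \<subseteq> H i" for i unfolding H_def by (rule hull_subset)
  have uniq: "P = Q" if "P \<in> pt ` Ed" "Q \<in> pt ` Ed" "fst P = fst Q" for P Q
    using that inj unfolding inj_on_def by fastforce
  have end_in: "\<exists>b. (t, b) \<in> C i" if "i \<in> I" "t \<in> {l i, r i}" for i t
  proof -
    have "l i \<in> fst ` C i" "r i \<in> fst ` C i" unfolding l_def r_def using finC Cne that(1) by auto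
    then show ?thesis using that(2) by force
  qed
  have slice: "\<exists>b. (t, b) \<in> H i" if "i \<in> I" "t \<in> {l i..r i}" for i t
  proof -
    have "l i \<in> fst ` H i" "r i \<in> fst ` H i" using end_in[OF that(1)] CH by force+
    moreover have "convex (fst ` H i)"
      by (rule convex_linear_image[OF linear_fst]) (simp add: H_def)
    ultimately have "{l i..r i} \<subseteq> fst ` H i"
      using closed_segment_subset[of "l i" "fst ` H i" "r i"] that(2)
      by (simp add: closed_segment_eq_real_ivl)
    then have "t \<in> fst ` H i" using that(2) by blast
    then show ?thesis by force
  qed
  have \<phi>H: "(t, \<phi> i t) \<in> H i \<and> ((\<exists>b'. (t, b') \<in> C i) \<longrightarrow> (t, \<phi> i t) \<in> C i)"
    if "i \<in> I" "t \<in> {l i..r i}" for i t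
    unfolding \<phi>_def by (rule someI_ex) (use slice[OF that] CH in blast)
  have range: "fst P \<in> {l i..r i}" if "P \<in> C i" for P i
    unfolding l_def r_def using finC that by auto
  have \<phi>C: "\<phi> i (fst P) = snd P" if "i \<in> I" "P \<in> C i" for i P
  proof -
    have "(fst P, \<phi> i (fst P)) \<in> C i"
      using \<phi>H[OF that(1) range[OF that(2)]] that(2) by (metis prod.collapse)
    then show ?thesis using uniq[of P "(fst P, \<phi> i (fst P))"] that CE by (metis fst_conv snd_conv subsetD)
  qed
  have sep: "(\<forall>t\<in>{l i..r i} \<inter> {l j..r j}. \<phi> i t \<le> \<phi> j t) \<or> (\<forall>t\<in>{l i..r i} \<inter> {l j..r j}. \<phi> j t \<le> \<phi> i t)"
    if "i \<in> I" "j \<in> I" "n \<noteq> 0" "\<forall>z\<in>H i. n \<bullet> z \<le> c" "\<forall>z\<in>H j. c \<le> n \<bullet> z" for i j n c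
    by (rule separated_sections_ordered[OF that(3-5)]) (use \<phi>H that in auto)
  have disj: "(\<forall>t\<in>{l i..r i} \<inter> {l j..r j}. \<phi> i t \<le> \<phi> j t) \<or> (\<forall>t\<in>{l i..r i} \<inter> {l j..r j}. \<phi> j t \<le> \<phi> i t)"
    if ij: "i \<in> I" "j \<in> I" "H i \<inter> H j = {}" for i j
  proof -
    have "H i \<noteq> {}" "H j \<noteq> {}" using Cne[OF ij(1)] Cne[OF ij(2)] CH by auto
    then obtain n c where "n \<noteq> 0" "\<forall>z\<in>H i. n \<bullet> z \<le> c" "\<forall>z\<in>H j. c \<le> n \<bullet> z"
      using separating_hyperplane_sets[of "H i" "H j"] ij(3) unfolding H_def by auto
    then show ?thesis using sep ij by blast
  qed
  have touch: "(\<forall>t\<in>{l i..r i} \<inter> {l j..r j}. \<phi> i t \<le> \<phi> j t) \<or> (\<forall>t\<in>{l i..r i} \<inter> {l j..r j}. \<phi> j t \<le> \<phi> i t)"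
    if ij: "i \<in> I" "j \<in> I" "H i \<inter> H j \<subseteq> {P}" "P \<in> C i" "P \<in> C j" "P \<notin> convex hull (C i - {P})" for i j P
  \<comment> \<open>A polygon reduced to a point has a one-point domain, so no separating line is
    needed.\<close>
  proof (cases "C i = {P}")
    case True
    then have "l i = r i" unfolding l_def r_def by simp
    then show ?thesis by (metis IntD1 atLeastAtMost_singleton linear singletonD)
  next
    case False
    obtain n c where "n \<noteq> 0" "\<forall>z\<in>H j. n \<bullet> z \<le> c" "\<forall>z\<in>H i. c \<le> n \<bullet> z"
      using separating_hyperplane_touching_hulls[OF _ ij(4,5,6) False] ij(3) unfolding H_def by metis
    then show ?thesis using sep[OF ij(2,1)] by (metis Int_commute)
  qed
  have redblue: "(\<forall>t\<in>{l i..r i} \<inter> {l j..r j}. \<phi> i t \<le> \<phi> j t) \<or> (\<forall>t\<in>{l i..r i} \<inter> {l j..r j}. \<phi> j t \<le> \<phi> i t)"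
    if ij: "i \<in> I" "j \<in> I" "i = Inl x" "j = Inr y" for i j x y
  proof (cases "H i \<inter> H j = {}")
    case False
    then have e: "(x, y) \<in> Ed" and sub: "H i \<inter> H j \<subseteq> {pt (x, y)}"
      using rb[of _ x y] ij unfolding H_def C_def by auto
    have P: "pt (x, y) \<in> C i" "pt (x, y) \<in> C j" using e ij unfolding C_def red_def blue_def by auto
    show ?thesis
    proof (cases "pt (x, y) \<notin> convex hull (C i - {pt (x, y)})")
      case True then show ?thesis using touch[OF ij(1,2) sub P] by blast
    next
      case False
      then have "pt (x, y) \<notin> convex hull (C j - {pt (x, y)})" using ext[OF e] ij unfolding C_def by auto
      then show ?thesis using touch[OF ij(2,1) _ P(2,1)] sub by (metis Int_commute)
    qed
  qed (use disj ij in blast)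
  have HD: "H (Inl x) \<inter> H (Inl z) = {}" if "x \<noteq> z" for x z using rr[OF that] unfolding H_def C_def by simp
  have HD': "H (Inr x) \<inter> H (Inr z) = {}" if "x \<noteq> z" for x z using bb[OF that] unfolding H_def C_def by simp
  have cons: "(\<forall>t\<in>{l i..r i} \<inter> {l j..r j}. \<phi> i t \<le> \<phi> j t) \<or> (\<forall>t\<in>{l i..r i} \<inter> {l j..r j}. \<phi> j t \<le> \<phi> i t)"
    if ij: "i \<in> I" "j \<in> I" "i \<noteq> j" for i j
  proof (cases i; cases j)
    fix x z assume "i = Inl x" "j = Inl z" then show ?thesis using disj[OF ij(1,2)] HD ij(3) by blast
  next
    fix x y assume "i = Inl x" "j = Inr y" then show ?thesis using redblue[OF ij(1,2)] by blast
  next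
    fix x y assume "i = Inr x" "j = Inl y" then show ?thesis using redblue[OF ij(2,1)] by (metis Int_commute)
  next
    fix x z assume "i = Inr x" "j = Inr z" then show ?thesis using disj[OF ij(1,2)] HD' ij(3) by blast
  qed
  \<comment> \<open>A point of the plane lies in at most one red and at most one blue hull.\<close>
  have two: "card {i\<in>I. t \<in> {l i..r i} \<and> \<phi> i t = v} \<le> 2" for t v
  proof -
    let ?A = "{i\<in>I. t \<in> {l i..r i} \<and> \<phi> i t = v}"
    have inH: "(t, v) \<in> H i" if "i \<in> ?A" for i using that \<phi>H by auto
    have fA: "finite ?A" using finI by simp
    have "x = z" if "Inl x \<in> ?A" "Inl z \<in> ?A" for x z using inH[OF that(1)] inH[OF that(2)] HD by blast
    then have "card (?A \<inter> range Inl) \<le> Suc 0"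
      using fA by (subst card_le_Suc0_iff_eq) auto
    moreover have "x = z" if "Inr x \<in> ?A" "Inr z \<in> ?A" for x z using inH[OF that(1)] inH[OF that(2)] HD' by blast
    then have "card (?A \<inter> range Inr) \<le> Suc 0"
      using fA by (subst card_le_Suc0_iff_eq) auto
    moreover have "?A \<subseteq> (?A \<inter> range Inl) \<union> (?A \<inter> range Inr)" unfolding I_def by auto
    then have "card ?A \<le> card ((?A \<inter> range Inl) \<union> (?A \<inter> range Inr))" using finI by (intro card_mono) auto
    then have "card ?A \<le> card (?A \<inter> range Inl) + card (?A \<inter> range Inr)"
      using card_Un_le order_trans by blast
    ultimately show ?thesis by linarith
  qed
  have ends: "\<phi> i t = \<phi> j t" if ij: "i \<in> I" "j \<in> I" "t \<in> {l i, r i}" "t \<in> {l j, r j}" for i j t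
  proof -
    obtain b b' where b: "(t, b) \<in> C i" "(t, b') \<in> C j" using end_in ij by meson
    then have "(t, b) = (t, b')" using CE by (intro uniq) auto
    then show ?thesis using \<phi>C[OF ij(1) b(1)] \<phi>C[OF ij(2) b(2)] by simp
  qed
  define M where "M = {(i,j). i \<in> I \<and> j \<in> I \<and> i \<noteq> j \<and>
           (\<exists>t. l i < t \<and> t \<le> r i \<and> l j < t \<and> t \<le> r j \<and> \<phi> i t = \<phi> j t)}"
  have cardM: "card M \<le> 64 * card I"
    unfolding M_def using finI cons two ends by (rule touching_pairs_bound)
  have finM: "finite M" by (rule finite_subset[of _ "I \<times> I"]) (use finI in \<open>auto simp: M_def\<close>)
  \<comment> \<open>These are the edges at the left end of some polygon, where the strict
    \<open>l i < t\<close> of the sweep can fail.\<close>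
  define X where "X = {e\<in>Ed. fst (pt e) \<in> l ` I}"
  have "card X \<le> card (l ` I)"
  proof (rule card_inj_on_le[where f = "fst \<circ> pt"])
    show "inj_on (fst \<circ> pt) X" using inj by (rule inj_on_subset) (auto simp: X_def)
  qed (use finI in \<open>auto simp: X_def\<close>)
  also have "\<dots> \<le> card I" by (rule card_image_le[OF finI])
  finally have cX: "card X \<le> card I" .
  have "card (Ed - X) \<le> card M"
  proof (rule card_inj_on_le[where f = "\<lambda>(x, y). (Inl x, Inr y)"])
    show "(\<lambda>(x, y). (Inl x, Inr y)) ` (Ed - X) \<subseteq> M"
    proof safe
      fix x y assume e: "(x, y) \<in> Ed" "(x, y) \<notin> X"
      have I: "Inl x \<in> I" "Inr y \<in> I" unfolding I_def using e by force+
      have P: "pt (x, y) \<in> C (Inl x)" "pt (x, y) \<in> C (Inr y)"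
        using e unfolding C_def red_def blue_def by auto
      have "fst (pt (x, y)) \<noteq> l (Inl x)" "fst (pt (x, y)) \<noteq> l (Inr y)" using e I unfolding X_def by auto
      then have "l (Inl x) < fst (pt (x, y)) \<and> fst (pt (x, y)) \<le> r (Inl x) \<and>
          l (Inr y) < fst (pt (x, y)) \<and> fst (pt (x, y)) \<le> r (Inr y) \<and>
          \<phi> (Inl x) (fst (pt (x, y))) = \<phi> (Inr y) (fst (pt (x, y)))"
        using range[OF P(1)] range[OF P(2)] \<phi>C[OF I(1) P(1)] \<phi>C[OF I(2) P(2)] by auto
      then show "(Inl x, Inr y) \<in> M" unfolding M_def using I by blast
    qed
  qed (use finM in \<open>auto simp: inj_on_def\<close>)
  moreover have "card Ed = card X + card (Ed - X)"
    using fin by (metis (no_types, lifting) X_def card_Diff_subset card_mono finite_subset le_add_diff_inverse mem_Collect_eq subsetI)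
  ultimately have "card Ed \<le> 65 * card I" using cX cardM by simp
  then show ?thesis by (simp only: cardI)
qed

section \<open>Cones of diameter directions\<close>

text \<open>Finitely many hyperplanes form a null set. This supplies both generic functionals: the
  one orienting the edges and the horizontal coordinate of the projection.\<close>

lemma exists_nonorthogonal:
  fixes W :: "'a::euclidean_space set"
  assumes "finite W" "0 \<notin> W"
  obtains f where "\<forall>w\<in>W. w \<bullet> f \<noteq> 0"
proof -
  have "negligible (\<Union>w\<in>W. {x. w \<bullet> x = 0})"
    using assms by (intro negligible_Union) (auto intro!: negligible_hyperplane)
  then have "(\<Union>w\<in>W. {x. w \<bullet> x = 0}) \<noteq> UNIV" using non_negligible_UNIV by metis
  then show ?thesis using that by auto
qed

text \<open>Undoes the central projection: the conic combinations of the \<open>v e\<close> form a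
  convex set containing the rescaled generators. The \<open>v e\<close> will be unit vectors, to
  which norm estimates apply.\<close>

lemma convex_hull_scaled_imp_conic:
  assumes fin: "finite S" and z: "z \<in> convex hull ((\<lambda>e. c e *\<^sub>R v e) ` S)" and c: "\<And>e. e \<in> S \<Longrightarrow> 0 \<le> c e"
  obtains a where "\<forall>e\<in>S. 0 \<le> (a e :: real)" "z = (\<Sum>e\<in>S. a e *\<^sub>R v e)"
proof -
  let ?K = "{\<Sum>e\<in>S. a e *\<^sub>R v e |a. \<forall>e\<in>S. 0 \<le> (a e :: real)}"
  have "convex ?K"
  proof (rule convexI)
    fix x y u w assume "x \<in> ?K" "y \<in> ?K" and uw: "0 \<le> u" "0 \<le> w" "u + w = (1::real)"
    then obtain a b where a: "\<forall>e\<in>S. 0 \<le> (a e :: real)" "x = (\<Sum>e\<in>S. a e *\<^sub>R v e)"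
      and b: "\<forall>e\<in>S. 0 \<le> (b e :: real)" "y = (\<Sum>e\<in>S. b e *\<^sub>R v e)" by auto
    have "u *\<^sub>R x + w *\<^sub>R y = (\<Sum>e\<in>S. (u * a e + w * b e) *\<^sub>R v e)"
      unfolding a b by (simp add: scaleR_sum_right sum.distrib scaleR_add_left)
    moreover have "\<forall>e\<in>S. 0 \<le> u * a e + w * b e" using a b uw by auto
    ultimately show "u *\<^sub>R x + w *\<^sub>R y \<in> ?K"
      by (intro CollectI exI[of _ "\<lambda>e. u * a e + w * b e"]) simp
  qed
  moreover have "(\<lambda>e. c e *\<^sub>R v e) ` S \<subseteq> ?K"
  proof safe
    fix e assume e: "e \<in> S"
    have "(\<Sum>e'\<in>S. (if e' = e then c e else 0) *\<^sub>R v e') = (\<Sum>e'\<in>S. if e' = e then c e *\<^sub>R v e else 0)"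
      by (rule sum.cong) auto
    also have "\<dots> = c e *\<^sub>R v e" using fin e by (simp add: sum.delta)
    finally show "\<exists>a. c e *\<^sub>R v e = (\<Sum>e\<in>S. a e *\<^sub>R v e) \<and> (\<forall>e\<in>S. 0 \<le> (a e :: real))"
      using c e by (intro exI[of _ "\<lambda>e'. if e' = e then c e else 0"]) auto
  qed
  ultimately have "convex hull ((\<lambda>e. c e *\<^sub>R v e) ` S) \<subseteq> ?K" by (intro hull_minimal)
  then show ?thesis using z that by auto
qed

text \<open>For adjacent vertices \<open>x\<close>, \<open>y\<close> at distance \<open>1\<close> this says that the cone of directions leaving \<open>x\<close>
  and the cone of directions entering \<open>y\<close> meet only in the ray of \<open>d = y - x\<close>, which moreover is an
  extreme ray of one of the two; for non-adjacent vertices the cones meet only in \<open>0\<close>.\<close>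

lemma direction_cones_contact:
  fixes d s :: "'a::real_inner" and v :: "'e \<Rightarrow> 'a" and w :: "'f \<Rightarrow> 'a"
  assumes v: "\<And>e. e \<in> S \<Longrightarrow> norm (v e) = 1" and w: "\<And>e. e \<in> T \<Longrightarrow> norm (w e) = 1"
    and d: "norm d \<le> 1" and vw: "\<And>e e'. e \<in> S \<Longrightarrow> e' \<in> T \<Longrightarrow> norm (v e + w e' - d) \<le> 1"
    and a: "\<And>e. e \<in> S \<Longrightarrow> 0 \<le> a e" and b: "\<And>e. e \<in> T \<Longrightarrow> 0 \<le> b e"
    and sa: "s = (\<Sum>e\<in>S. a e *\<^sub>R v e)" and sb: "s = (\<Sum>e\<in>T. b e *\<^sub>R w e)" and s: "s \<noteq> 0"
  shows "norm d = 1" "d \<bullet> s = norm s" "sum a S = norm s \<or> sum b T = norm s"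
proof -
  define A B \<sigma> \<delta> where "A = sum a S" and "B = sum b T" and "\<sigma> = norm s" and "\<delta> = norm d"
  have \<sigma>: "\<sigma> > 0" using s \<sigma>_def by simp
  have "norm s \<le> (\<Sum>e\<in>S. norm (a e *\<^sub>R v e))" unfolding sa by (rule norm_sum)
  also have "\<dots> = A" unfolding A_def by (rule sum.cong) (use a v in auto)
  finally have A: "\<sigma> \<le> A" unfolding \<sigma>_def .
  have "norm s \<le> (\<Sum>e\<in>T. norm (b e *\<^sub>R w e))" unfolding sb by (rule norm_sum)
  also have "\<dots> = B" unfolding B_def by (rule sum.cong) (use b w in auto)
  finally have B: "\<sigma> \<le> B" unfolding \<sigma>_def .
  \<comment> \<open>With \<open>d = y - x\<close>, \<open>v e\<close> leaving \<open>x\<close> and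
    \<open>w e'\<close> entering \<open>y\<close>, the bounded norm is the distance between the two
    other endpoints. Its square is expanded.\<close>
  have pair: "1 + \<delta>\<^sup>2 + 2 * (v e \<bullet> w e') - 2 * (d \<bullet> v e) - 2 * (d \<bullet> w e') \<le> 0" if "e \<in> S" "e' \<in> T" for e e'
  proof -
    have "(norm (v e + w e' - d))\<^sup>2 \<le> 1" using vw[OF that] by (simp add: power_le_one)
    moreover have "(norm (v e + w e' - d))\<^sup>2 =
        (norm (v e))\<^sup>2 + (norm (w e'))\<^sup>2 + \<delta>\<^sup>2 + 2 * (v e \<bullet> w e') - 2 * (d \<bullet> v e) - 2 * (d \<bullet> w e')"
      unfolding \<delta>_def by (simp add: power2_norm_eq_inner inner_add_left inner_add_right inner_diff_left inner_diff_right inner_commute)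
    ultimately show ?thesis using v[OF that(1)] w[OF that(2)] by simp
  qed
  \<comment> \<open>Summing the pair inequality with weights \<open>b\<close>, and afterwards with
    weights \<open>a\<close>, replaces both unit vectors by \<open>s\<close>.\<close>
  have one: "B * (1 + \<delta>\<^sup>2) + 2 * (v e \<bullet> s) - 2 * B * (d \<bullet> v e) - 2 * (d \<bullet> s) \<le> 0" if "e \<in> S" for e
  proof -
    have "(\<Sum>e'\<in>T. b e' * (1 + \<delta>\<^sup>2 + 2 * (v e \<bullet> w e') - 2 * (d \<bullet> v e) - 2 * (d \<bullet> w e'))) \<le> 0"
      by (intro sum_nonpos mult_nonneg_nonpos b pair that)
    also have "(\<Sum>e'\<in>T. b e' * (1 + \<delta>\<^sup>2 + 2 * (v e \<bullet> w e') - 2 * (d \<bullet> v e) - 2 * (d \<bullet> w e')))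
       = B * (1 + \<delta>\<^sup>2) + 2 * (v e \<bullet> s) - 2 * B * (d \<bullet> v e) - 2 * (d \<bullet> s)"
      unfolding B_def sb by (simp add: algebra_simps sum.distrib sum_subtractf sum_distrib_left sum_distrib_right inner_sum_right)
    finally show ?thesis .
  qed
  have "(\<Sum>e\<in>S. a e * (B * (1 + \<delta>\<^sup>2) + 2 * (v e \<bullet> s) - 2 * B * (d \<bullet> v e) - 2 * (d \<bullet> s))) \<le> 0"
    by (intro sum_nonpos mult_nonneg_nonpos a one)
  also have "(\<Sum>e\<in>S. a e * (B * (1 + \<delta>\<^sup>2) + 2 * (v e \<bullet> s) - 2 * B * (d \<bullet> v e) - 2 * (d \<bullet> s)))
     = A * B * (1 + \<delta>\<^sup>2) + 2 * ((\<Sum>e\<in>S. a e *\<^sub>R v e) \<bullet> s) - 2 * B * (d \<bullet> (\<Sum>e\<in>S. a e *\<^sub>R v e)) - 2 * A * (d \<bullet> s)"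
    unfolding A_def by (simp add: algebra_simps sum.distrib sum_subtractf sum_distrib_left sum_distrib_right inner_sum_right inner_sum_left)
  finally have le: "A * B * (1 + \<delta>\<^sup>2) + 2 * \<sigma>\<^sup>2 - 2 * (A + B) * (d \<bullet> s) \<le> 0"
    unfolding sa[symmetric] \<sigma>_def by (simp add: power2_norm_eq_inner algebra_simps)
  have \<delta>: "0 \<le> \<delta>" "\<delta> \<le> 1" using d \<delta>_def by auto
  have cs: "d \<bullet> s \<le> \<delta> * \<sigma>" unfolding \<delta>_def \<sigma>_def by (rule norm_cauchy_schwarz)
  \<comment> \<open>The left side of \<open>le\<close> is regrouped into four terms, each
    nonnegative by the triangle inequality (\<open>\<sigma> \<le> A\<close>,
    \<open>\<sigma> \<le> B\<close>), Cauchy-Schwarz or \<open>\<delta> \<le> 1\<close>. All four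
    must vanish, which yields the equality cases.\<close>
  have "A * B * (1 - \<delta>)\<^sup>2 + 2 * \<sigma>\<^sup>2 * (1 - \<delta>) + 2 * \<delta> * ((A - \<sigma>) * (B - \<sigma>)) + 2 * ((A + B) * (\<delta> * \<sigma> - d \<bullet> s)) \<le> 0"
    using le by (simp add: algebra_simps power2_eq_square)
  moreover have "0 \<le> A * B * (1 - \<delta>)\<^sup>2" "0 \<le> 2 * \<sigma>\<^sup>2 * (1 - \<delta>)" "0 \<le> 2 * \<delta> * ((A - \<sigma>) * (B - \<sigma>))"
      "0 \<le> 2 * ((A + B) * (\<delta> * \<sigma> - d \<bullet> s))"
    using \<delta> cs A B \<sigma> by auto
  ultimately have z: "2 * \<sigma>\<^sup>2 * (1 - \<delta>) = 0" "2 * \<delta> * ((A - \<sigma>) * (B - \<sigma>)) = 0" "2 * ((A + B) * (\<delta> * \<sigma> - d \<bullet> s)) = 0"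
    by linarith+
  show "norm d = 1" using z(1) \<sigma> \<delta>_def by simp
  then show "d \<bullet> s = norm s" "sum a S = norm s \<or> sum b T = norm s"
    using z(2,3) \<sigma> A B unfolding \<delta>_def A_def B_def \<sigma>_def by auto
qed

text \<open>\<open>sum a S - d \<bullet> s\<close> combines the strictly positive numbers
  \<open>1 - d \<bullet> v e\<close> with weights \<open>a\<close>, so its vanishing kills every
  weight. Hence, on the side where the norm bound is tight, no nonzero combination survives without
  the vector \<open>d\<close>.\<close>

lemma conic_combination_tight:
  fixes d s :: "'a::real_inner"
  assumes fin: "finite S" and v: "\<And>e. e \<in> S \<Longrightarrow> norm (v e) = 1 \<and> v e \<noteq> d" and a: "\<And>e. e \<in> S \<Longrightarrow> 0 \<le> a e"
    and s: "s = (\<Sum>e\<in>S. a e *\<^sub>R v e)" and d: "norm d = 1" "d \<bullet> s = norm s" and A: "sum a S = norm s"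
  shows "s = 0"
proof -
  have lt: "d \<bullet> v e < 1" if "e \<in> S" for e
  proof -
    have "d \<bullet> v e \<le> norm d * norm (v e)" by (rule norm_cauchy_schwarz)
    moreover have "d \<bullet> v e \<noteq> norm d * norm (v e)"
      using v[OF that] d by (metis norm_cauchy_schwarz_eq scaleR_one)
    ultimately show ?thesis using v[OF that] d by simp
  qed
  have "(\<Sum>e\<in>S. a e * (1 - d \<bullet> v e)) = sum a S - d \<bullet> s"
    unfolding s by (simp add: algebra_simps sum_subtractf inner_sum_right)
  then have "(\<Sum>e\<in>S. a e * (1 - d \<bullet> v e)) = 0" using A d by simp
  then have "\<forall>e\<in>S. a e * (1 - d \<bullet> v e) = 0"
    using sum_nonneg_eq_0_iff[OF fin, of "\<lambda>e. a e * (1 - d \<bullet> v e)"] a lt by (simp add: less_imp_le)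
  then have "\<forall>e\<in>S. a e = 0" using lt by force
  then show ?thesis unfolding s by simp
qed

section \<open>Linear edge bound for diameter graphs in dimension three\<close>

text \<open>The vector \<open>w\<close> certifies that \<open>e\<close> and \<open>f\<close> are
  independent, so \<open>e\<close>, \<open>f\<close>, \<open>cross3 e f\<close> form a basis. On a
  plane where the product with \<open>e\<close> is constant, the other two products are then
  injective coordinates.\<close>

lemma cross3_coordinates_inj:
  fixes u e f w :: "real^3"
  assumes "u \<bullet> e = 0" "u \<bullet> f = 0" "u \<bullet> cross3 e f = 0" and w: "w \<bullet> e = 0" "w \<bullet> f \<noteq> 0" and e: "e \<noteq> 0"
  shows "u = 0"
proof -
  have "cross3 u (cross3 e f) = 0"
    using assms(1,2) Lagrange[of u e f] by (simp add: Lagrange inner_commute)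
  then have "u = 0 \<or> cross3 e f = 0" using assms(3) norm_and_cross_eq_0 by blast
  moreover have "cross3 e f \<noteq> 0"
  proof
    assume "cross3 e f = 0"
    then have "collinear {0, e, f}" by (simp add: cross_eq_0)
    then obtain c where "f = c *\<^sub>R e" using e by (auto simp: collinear_lemma)
    then show False using w by simp
  qed
  ultimately show ?thesis by simp
qed

text \<open>Scaling the directions into the plane \<open>z \<bullet> e = 1\<close> turns the stars
  of outgoing and incoming edges into the red and blue polygons of
  \<open>contact_edges_bound\<close>. Each colour has at most \<open>card V\<close> polygons, hence
  \<open>130 = 2 * 65\<close>.\<close>

lemma oriented_diameters_bound:
  fixes V :: "(real^3) set" and e :: "real^3"
  assumes finV: "finite V" and diam: "\<And>x y. x \<in> V \<Longrightarrow> y \<in> V \<Longrightarrow> norm (y - x) \<le> 1"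
  shows "card {(x, y) \<in> V \<times> V. norm (y - x) = 1 \<and> (y - x) \<bullet> e > 0} \<le> 130 * card V"
proof -
  define Ed where "Ed = {(x, y) \<in> V \<times> V. norm (y - x) = 1 \<and> (y - x) \<bullet> e > 0}"
  define v where "v = (\<lambda>a :: (real^3) \<times> (real^3). snd a - fst a)"
  define Z where "Z = (\<lambda>a. (1 / (v a \<bullet> e)) *\<^sub>R v a)"
  define Ro where "Ro x = {a\<in>Ed. fst a = x}" for x
  define Bo where "Bo y = {a\<in>Ed. snd a = y}" for y
  have finE: "finite Ed" unfolding Ed_def by (rule finite_subset[of _ "V \<times> V"]) (use finV in auto)
  have E: "norm (v a) = 1" "v a \<bullet> e > 0" "fst a \<in> V" "snd a \<in> V" if "a \<in> Ed" for a
    using that unfolding Ed_def v_def by auto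
  have Ze: "Z a \<bullet> e = 1" if "a \<in> Ed" for a using E[OF that] unfolding Z_def by simp
  have hull_e: "z \<bullet> e = 1" if "z \<in> convex hull (Z ` S)" "S \<subseteq> Ed" for z S
  proof -
    have "convex hull (Z ` S) \<subseteq> {z. e \<bullet> z = 1}"
    proof (rule hull_minimal)
      show "Z ` S \<subseteq> {z. e \<bullet> z = 1}" using Ze that(2) by (auto simp: inner_commute[of e])
    qed (rule convex_hyperplane)
    then show ?thesis using that(1) by (auto simp: inner_commute)
  qed
  have half: "z \<bullet> D > 0" if "z \<in> convex hull (Z ` S)" "S \<subseteq> Ed" "\<And>a. a \<in> S \<Longrightarrow> v a \<bullet> D > 0" for z S D
  proof -
    have "convex hull (Z ` S) \<subseteq> {z. D \<bullet> z > 0}"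
    proof (rule hull_minimal)
      show "convex {z. D \<bullet> z > 0}" using convex_halfspace_gt[of 0 D] by simp
      show "Z ` S \<subseteq> {z. D \<bullet> z > 0}" unfolding Z_def using E that(2,3) by (auto simp: inner_commute)
    qed
    then show ?thesis using that(1) by (auto simp: inner_commute)
  qed
  \<comment> \<open>Expanding the square gives
    \<open>2 * (v a \<bullet> D) \<ge> (norm D)\<^sup>2\<close>. With \<open>D\<close> the
    difference of two vertices, the directions at one have positive product with \<open>D\<close>
    and those at the other with \<open>- D\<close>, so hulls of equal colour are disjoint.\<close>
  have pos: "v a \<bullet> D > 0" if "norm (v a) = 1" "norm (v a - D) \<le> 1" "D \<noteq> 0" for a D
  proof -
    have "(norm (v a - D))\<^sup>2 \<le> 1" using that(2) by (simp add: power_le_one)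
    moreover have "(norm (v a - D))\<^sup>2 = (norm (v a))\<^sup>2 + (norm D)\<^sup>2 - 2 * (v a \<bullet> D)"
      by (simp add: power2_norm_eq_inner inner_diff_left inner_diff_right inner_commute)
    moreover have "(norm D)\<^sup>2 > 0" using that(3) by simp
    moreover have "(norm (v a))\<^sup>2 = 1" using that(1) by simp
    ultimately show ?thesis by linarith
  qed
  have rr: "False" if "z \<in> convex hull (Z ` Ro x)" "z \<in> convex hull (Z ` Ro x')" "x \<noteq> x'" for z x x'
  proof -
    have ne: "Ro x \<noteq> {}" "Ro x' \<noteq> {}" using that by auto
    then have V: "x \<in> V" "x' \<in> V" using E unfolding Ro_def by auto
    have "z \<bullet> (x' - x) > 0"
    proof (rule half[OF that(1)])
      fix a assume a: "a \<in> Ro x"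
      then have "norm (v a - (x' - x)) \<le> 1"
        using diam[of x' "snd a"] V E unfolding Ro_def v_def by (auto simp: algebra_simps)
      then show "v a \<bullet> (x' - x) > 0" using pos E a that(3) unfolding Ro_def by auto
    qed (auto simp: Ro_def)
    moreover have "z \<bullet> (x - x') > 0"
    proof (rule half[OF that(2)])
      fix a assume a: "a \<in> Ro x'"
      then have "norm (v a - (x - x')) \<le> 1"
        using diam[of x "snd a"] V E unfolding Ro_def v_def by (auto simp: algebra_simps)
      then show "v a \<bullet> (x - x') > 0" using pos E a that(3) unfolding Ro_def by auto
    qed (auto simp: Ro_def)
    ultimately show False by (simp add: inner_diff_right)
  qed
  have bb: "False" if "z \<in> convex hull (Z ` Bo y)" "z \<in> convex hull (Z ` Bo y')" "y \<noteq> y'" for z y y'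
  proof -
    have ne: "Bo y \<noteq> {}" "Bo y' \<noteq> {}" using that by auto
    then have V: "y \<in> V" "y' \<in> V" using E unfolding Bo_def by auto
    have "z \<bullet> (y - y') > 0"
    proof (rule half[OF that(1)])
      fix a assume a: "a \<in> Bo y"
      then have "norm (v a - (y - y')) \<le> 1"
        using diam[of "fst a" y'] V E unfolding Bo_def v_def by (auto simp: algebra_simps)
      then show "v a \<bullet> (y - y') > 0" using pos E a that(3) unfolding Bo_def by auto
    qed (auto simp: Bo_def)
    moreover have "z \<bullet> (y' - y) > 0"
    proof (rule half[OF that(2)])
      fix a assume a: "a \<in> Bo y'"
      then have "norm (v a - (y' - y)) \<le> 1"
        using diam[of "fst a" y] V E unfolding Bo_def v_def by (auto simp: algebra_simps)
      then show "v a \<bullet> (y' - y) > 0" using pos E a that(3) unfolding Bo_def by auto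
    qed (auto simp: Bo_def)
    ultimately show False by (simp add: inner_diff_right)
  qed
  have injZ: "inj_on Z Ed"
  proof (rule inj_onI)
    fix a b assume ab: "a \<in> Ed" "b \<in> Ed" "Z a = Z b"
    have "fst a = fst b"
      using rr[of "Z a" "fst a" "fst b"] ab unfolding Ro_def by (metis (mono_tags, lifting) hull_inc image_eqI mem_Collect_eq)
    moreover have "snd a = snd b"
      using bb[of "Z a" "snd a" "snd b"] ab unfolding Bo_def by (metis (mono_tags, lifting) hull_inc image_eqI mem_Collect_eq)
    ultimately show "a = b" by (simp add: prod_eq_iff)
  qed
  have conic: "\<exists>c. (\<forall>a\<in>S. 0 \<le> c a) \<and> z = (\<Sum>a\<in>S. c a *\<^sub>R v a)"
    if "z \<in> convex hull (Z ` S)" "S \<subseteq> Ed" for z S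
  proof -
    have "finite S" using that(2) finE finite_subset by blast
    moreover have "0 \<le> 1 / (v a \<bullet> e)" if "a \<in> S" for a using E[of a] that \<open>S \<subseteq> Ed\<close> by auto
    ultimately show ?thesis
      using convex_hull_scaled_imp_conic[of S z "\<lambda>a. 1 / (v a \<bullet> e)" v] that(1) unfolding Z_def by metis
  qed
  \<comment> \<open>Stated for subsets of the stars: full stars identify a common point with a
    projected edge, and stars without \<open>(x, y)\<close> show that this point is extreme on one
    side.\<close>
  have contact: "(x, y) \<in> Ed \<and> z = Z (x, y) \<and> \<not> (S \<subseteq> Ro x - {(x, y)} \<and> T \<subseteq> Bo y - {(x, y)})"
    if z: "z \<in> convex hull (Z ` S)" "z \<in> convex hull (Z ` T)" and ST: "S \<subseteq> Ro x" "T \<subseteq> Bo y" for x y z S T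
  proof -
    define d where "d = y - x"
    have SE: "S \<subseteq> Ed" "T \<subseteq> Ed" using ST unfolding Ro_def Bo_def by auto
    obtain a where a: "\<forall>e\<in>S. 0 \<le> a e" "z = (\<Sum>e\<in>S. a e *\<^sub>R v e)" using conic[OF z(1) SE(1)] by blast
    obtain b where b: "\<forall>e\<in>T. 0 \<le> b e" "z = (\<Sum>e\<in>T. b e *\<^sub>R v e)" using conic[OF z(2) SE(2)] by blast
    have ze: "z \<bullet> e = 1" using hull_e z SE by blast
    then have z0: "z \<noteq> 0" by auto
    have "S \<noteq> {}" "T \<noteq> {}" using z by auto
    then have V: "x \<in> V" "y \<in> V" using ST E unfolding Ro_def Bo_def by blast+
    have nd: "norm d \<le> 1" unfolding d_def using diam V by blast
    have vw: "norm (v e1 + v e2 - d) \<le> 1" if "e1 \<in> S" "e2 \<in> T" for e1 e2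
    proof -
      have "fst e1 = x" "snd e2 = y" using that ST unfolding Ro_def Bo_def by auto
      then have "v e1 + v e2 - d = snd e1 - fst e2" unfolding v_def d_def by (simp add: algebra_simps)
      then show ?thesis using diam that SE E by (metis subsetD)
    qed
    have ES: "norm (v e) = 1" if "e \<in> S" for e using that SE E(1) by blast
    have ET: "norm (v e) = 1" if "e \<in> T" for e using that SE E(1) by blast
    note c = direction_cones_contact[of S v T v d a b z, OF ES ET nd vw a(1)[rule_format] b(1)[rule_format] a(2) b(2) z0]
    have "norm d *\<^sub>R z = norm z *\<^sub>R d" using c(1,2) norm_cauchy_schwarz_eq[of d z] by simp
    then have zd: "z = norm z *\<^sub>R d" using c(1) by simp
    have "norm z * (d \<bullet> e) = 1" using ze zd by (metis inner_scaleR_left)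
    then have nz: "d \<bullet> e > 0" "norm z = 1 / (d \<bullet> e)" using z0
      by (metis norm_ge_zero zero_less_mult_pos zero_less_norm_iff zero_less_one)
         (metis \<open>norm z * (d \<bullet> e) = 1\<close> mult_zero_right nonzero_eq_divide_eq zero_neq_one)
    have ed: "(x, y) \<in> Ed" unfolding Ed_def using V c(1) nz unfolding d_def by auto
    have zZ: "z = Z (x, y)" unfolding Z_def v_def using zd nz unfolding d_def by simp
    have "\<not> (S \<subseteq> Ro x - {(x, y)} \<and> T \<subseteq> Bo y - {(x, y)})"
    proof
      assume X: "S \<subseteq> Ro x - {(x, y)} \<and> T \<subseteq> Bo y - {(x, y)}"
      have fin: "finite S" "finite T" using SE finE finite_subset by blast+
      have S: "norm (v e) = 1 \<and> v e \<noteq> d" if "e \<in> S" for e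
        using that X SE E(1)[of e] unfolding Ro_def v_def d_def by (cases e) auto
      have T: "norm (v e) = 1 \<and> v e \<noteq> d" if "e \<in> T" for e
        using that X SE E(1)[of e] unfolding Bo_def v_def d_def by (cases e) auto
      from c(3) have "z = 0"
      proof
        assume "sum a S = norm z"
        then show "z = 0" using conic_combination_tight[OF fin(1) S _ a(2) c(1,2)] a(1) by blast
      next
        assume "sum b T = norm z"
        then show "z = 0" using conic_combination_tight[OF fin(2) T _ b(2) c(1,2)] b(1) by blast
      qed
      then show False using z0 by simp
    qed
    then show ?thesis using ed zZ by blast
  qed
  show ?thesis
  proof (cases "Ed = {}")
    case True then show ?thesis unfolding Ed_def[symmetric] by simp
  next
    case False
    then have e0: "e \<noteq> 0" using E(2) by fastforce
    then obtain w0 where w0: "w0 \<noteq> 0" "w0 \<bullet> e = 0"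
      using cross_basis_nonzero[OF e0] dot_cross_self by (metis inner_commute)
    \<comment> \<open>\<open>w0\<close> keeps \<open>f\<close> from being parallel to
      \<open>e\<close>, as the coordinates below require; the differences make the abscissas
      \<open>Z a \<bullet> f\<close> distinct.\<close>
    define W where "W = insert w0 ((\<lambda>(a, b). Z a - Z b) ` {(a, b) \<in> Ed \<times> Ed. a \<noteq> b})"
    have "finite {(a, b) \<in> Ed \<times> Ed. a \<noteq> b}" by (rule finite_subset[of _ "Ed \<times> Ed"]) (use finE in auto)
    then have "finite W" unfolding W_def by simp
    moreover have "0 \<notin> W" unfolding W_def using w0 injZ by (auto dest: inj_onD)
    ultimately obtain f where f: "\<forall>w\<in>W. w \<bullet> f \<noteq> 0" using exists_nonorthogonal by blast
    define L where "L z = (z \<bullet> f, z \<bullet> cross3 e f)" for z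
    have linL: "linear L" unfolding L_def by (intro linearI) (auto simp: inner_add_left)
    have injL: "z = z'" if "L z = L z'" "z \<bullet> e = 1" "z' \<bullet> e = 1" for z z'
    proof -
      have "z - z' = 0"
        by (rule cross3_coordinates_inj[of _ e f w0])
           (use that f w0 e0 in \<open>auto simp: L_def W_def inner_diff_left\<close>)
      then show ?thesis by simp
    qed
    define pt where "pt = (\<lambda>a. L (Z a))"
    have hullL: "convex hull (pt ` S) = L ` (convex hull (Z ` S))" for S
      unfolding pt_def by (metis (no_types) convex_hull_linear_image[OF linL] image_image)
    have common: "\<exists>z. q = L z \<and> z \<in> convex hull (Z ` S) \<and> z \<in> convex hull (Z ` T)"
      if q: "q \<in> convex hull (pt ` S)" "q \<in> convex hull (pt ` T)" and ST: "S \<subseteq> Ed" "T \<subseteq> Ed" for q S T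
    proof -
      obtain z z' where "q = L z" "q = L z'" "z \<in> convex hull (Z ` S)" "z' \<in> convex hull (Z ` T)"
        using q unfolding hullL by blast
      moreover from this have "z = z'" using injL hull_e ST by metis
      ultimately show ?thesis by blast
    qed
    have sub: "Ro x \<subseteq> Ed" "Bo x \<subseteq> Ed" for x unfolding Ro_def Bo_def by auto
    have "card Ed \<le> 65 * (card (fst ` Ed) + card (snd ` Ed))"
    proof (rule contact_edges_bound[of Ed pt], unfold Ro_def[symmetric] Bo_def[symmetric])
      show "inj_on (fst \<circ> pt) Ed"
      proof (rule inj_onI, rule ccontr)
        fix a b assume ab: "a \<in> Ed" "b \<in> Ed" "(fst \<circ> pt) a = (fst \<circ> pt) b" "a \<noteq> b"
        then have "Z a - Z b \<in> W" unfolding W_def by auto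
        then show False using f ab(3) unfolding pt_def L_def by (auto simp: inner_diff_left)
      qed
      show "convex hull (pt ` Ro x) \<inter> convex hull (pt ` Ro z) = {}" if "x \<noteq> z" for x z
        using common rr that sub by blast
      show "convex hull (pt ` Bo x) \<inter> convex hull (pt ` Bo z) = {}" if "x \<noteq> z" for x z
        using common bb that sub by blast
      show "(x, y) \<in> Ed \<and> q = pt (x, y)" if "q \<in> convex hull (pt ` Ro x)" "q \<in> convex hull (pt ` Bo y)" for x y q
        using common[OF that sub] contact[of _ "Ro x" "Bo y" x y] unfolding pt_def by blast
      show "pt (x, y) \<notin> convex hull (pt ` Ro x - {pt (x, y)}) \<or> pt (x, y) \<notin> convex hull (pt ` Bo y - {pt (x, y)})"
        if "(x, y) \<in> Ed" for x y
      proof (rule ccontr)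
        assume "\<not> ?thesis"
        moreover have "pt ` Ro x - {pt (x, y)} \<subseteq> pt ` (Ro x - {(x, y)})"
          "pt ` Bo y - {pt (x, y)} \<subseteq> pt ` (Bo y - {(x, y)})" by auto
        ultimately have "pt (x, y) \<in> convex hull (pt ` (Ro x - {(x, y)}))"
          "pt (x, y) \<in> convex hull (pt ` (Bo y - {(x, y)}))" by (meson hull_mono subsetD)+
        then obtain z where "z \<in> convex hull (Z ` (Ro x - {(x, y)}))" "z \<in> convex hull (Z ` (Bo y - {(x, y)}))"
          using common[of "pt (x, y)" "Ro x - {(x, y)}" "Bo y - {(x, y)}"] sub by blast
        then show False using contact[of z "Ro x - {(x, y)}" "Bo y - {(x, y)}" x y] by auto
      qed
    qed (rule finE)
    moreover have "card (fst ` Ed) \<le> card V" "card (snd ` Ed) \<le> card V"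
      using E finV by (auto intro!: card_mono)
    ultimately show ?thesis unfolding Ed_def[symmetric] by simp
  qed
qed

text \<open>After scaling the diameter to 1, a generic functional is nonzero on every edge, so each
  edge occurs among the oriented pairs already counted.\<close>

lemma diameter_graph_edges_bound:
  assumes dg: "is_diameter_graph TYPE(real^3) W E" and fin: "finite W"
  shows "card (E \<inter> {e. e \<subseteq> W \<and> card e = 2}) \<le> 130 * card W"
proof -
  obtain f :: "nat \<Rightarrow> real^3" where f: "inj_on f W"
    "\<And>u v. u \<in> W \<Longrightarrow> v \<in> W \<Longrightarrow> u \<noteq> v \<Longrightarrow> {u, v} \<in> E \<longleftrightarrow> dist (f u) (f v) = diameter (f ` W)"
    using dg unfolding is_diameter_graph_def by blast
  define D where "D = diameter (f ` W)"
  define g where "g u = (1 / D) *\<^sub>R f u" for u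
  have D: "dist (f u) (f v) \<le> D" if "u \<in> W" "v \<in> W" for u v
    unfolding D_def using fin that by (intro diameter_bounded_bound) (auto intro: finite_imp_bounded)
  \<comment> \<open>With at most one vertex \<open>D\<close> is 0 and so is \<open>1 / D\<close>;
    positivity is claimed only in the presence of two distinct vertices.\<close>
  have Dpos: "D > 0" if "u \<in> W" "v \<in> W" "u \<noteq> v" for u v
    using D[OF that(1,2)] f(1) that by (metis dist_pos_lt inj_onD less_le_trans)
  have ng: "norm (g v - g u) = dist (f u) (f v) / \<bar>D\<bar>" for u v
    unfolding g_def by (simp add: scaleR_diff_right[symmetric] dist_norm norm_minus_commute)
  have injg: "inj_on g W"
  proof (rule inj_onI, rule ccontr)
    fix u v assume "u \<in> W" "v \<in> W" "g u = g v" "u \<noteq> v"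
    then show False using Dpos f(1) unfolding g_def by (auto dest: inj_onD)
  qed
  define h where "h = inv_into W g"
  have h: "h (g u) = u" if "u \<in> W" for u unfolding h_def using injg that by simp
  let ?Df = "(\<lambda>(x, y). y - x) ` {(x, y) \<in> g ` W \<times> g ` W. x \<noteq> y}"
  have "finite {(x, y) \<in> g ` W \<times> g ` W. x \<noteq> y}" by (rule finite_subset[of _ "g ` W \<times> g ` W"]) (use fin in auto)
  moreover have "0 \<notin> ?Df" by auto
  ultimately obtain a where a: "\<forall>w\<in>?Df. w \<bullet> a \<noteq> 0" using exists_nonorthogonal[of ?Df] by blast
  define Ed where "Ed = {(x, y) \<in> g ` W \<times> g ` W. norm (y - x) = 1 \<and> (y - x) \<bullet> a > 0}"
  have finEd: "finite Ed" unfolding Ed_def by (rule finite_subset[of _ "g ` W \<times> g ` W"]) (use fin in auto)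
  have "norm (y - x) \<le> 1" if xy: "x \<in> g ` W" "y \<in> g ` W" for x y
  proof -
    obtain u v where uv: "u \<in> W" "v \<in> W" "x = g u" "y = g v" using xy by auto
    show ?thesis
    proof (cases "u = v")
      case False
      then show ?thesis using uv ng D[OF uv(1,2)] Dpos[OF uv(1,2)] by simp
    qed (use uv in simp)
  qed
  then have "card Ed \<le> 130 * card (g ` W)"
    unfolding Ed_def using fin by (intro oriented_diameters_bound) auto
  also have "card (g ` W) = card W" by (rule card_image[OF injg])
  finally have cEd: "card Ed \<le> 130 * card W" .
  have "E \<inter> {e. e \<subseteq> W \<and> card e = 2} \<subseteq> (\<lambda>(x, y). {h x, h y}) ` Ed"
  proof
    fix e assume "e \<in> E \<inter> {e. e \<subseteq> W \<and> card e = 2}"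
    then obtain u v where uv: "{u, v} \<in> E" "u \<in> W" "v \<in> W" "u \<noteq> v" "e = {u, v}"
      by (auto simp: card_2_iff)
    have n1: "norm (g v - g u) = 1" "norm (g u - g v) = 1"
      using f(2)[OF uv(2-4)] uv(1) Dpos[OF uv(2-4)] by (simp_all add: ng D_def dist_commute)
    have "g u \<noteq> g v" using n1 by auto
    then have "(g v - g u) \<bullet> a \<noteq> 0" using a uv by force
    then have "(g v - g u) \<bullet> a > 0 \<or> (g u - g v) \<bullet> a > 0" by (auto simp: inner_diff_left)
    then have "(g u, g v) \<in> Ed \<or> (g v, g u) \<in> Ed" unfolding Ed_def using n1 uv by auto
    then show "e \<in> (\<lambda>(x, y). {h x, h y}) ` Ed" using h uv by (force simp: insert_commute)
  qed
  then have "card (E \<inter> {e. e \<subseteq> W \<and> card e = 2}) \<le> card Ed" by (rule surj_card_le[OF finEd])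
  then show ?thesis using cEd by linarith
qed

section \<open>First moment over vertex sets of size \<open>k\<close>\<close>

text \<open>This is the generating function of the number of edges in \<open>B\<close>. Independence
  makes it a product in which a pair of \<open>B\<close> contributes \<open>1 - p + x * p\<close>
  and any other pair \<open>p + (1 - p) = 1\<close>.\<close>

lemma sum_Pow_power_weights:
  fixes p x :: real
  assumes fin: "finite A" and BA: "B \<subseteq> A"
  shows "(\<Sum>E\<in>Pow A. x ^ card (E \<inter> B) * (p ^ card E * (1 - p) ^ (card A - card E))) = (1 - p + x * p) ^ card B"
proof -
  have "(\<Sum>E\<in>Pow A. x ^ card (E \<inter> B) * (p ^ card E * (1 - p) ^ (card A - card E)))
      = (\<Sum>E\<in>Pow A. (\<Prod>e\<in>E. (if e \<in> B then x * p else p)) * (\<Prod>e\<in>A - E. 1 - p))"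
  proof (rule sum.cong)
    fix E assume "E \<in> Pow A"
    then have E: "E \<subseteq> A" "finite E" using fin finite_subset by auto
    have "(\<Prod>e\<in>E. (if e \<in> B then x * p else p)) = (\<Prod>e\<in>E. (if e \<in> B then x else 1) * p)"
      by (rule prod.cong) auto
    also have "\<dots> = (\<Prod>e\<in>E. (if e \<in> B then x else 1)) * p ^ card E" by (simp add: prod.distrib)
    also have "(\<Prod>e\<in>E. (if e \<in> B then x else 1)) = x ^ card (E \<inter> B)"
      using E(2) by (subst prod.inter_restrict[symmetric]) auto
    finally show "x ^ card (E \<inter> B) * (p ^ card E * (1 - p) ^ (card A - card E)) =
        (\<Prod>e\<in>E. (if e \<in> B then x * p else p)) * (\<Prod>e\<in>A - E. 1 - p)"
      using E by (simp add: card_Diff_subset)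
  qed simp
  also have "\<dots> = (\<Prod>e\<in>A. (if e \<in> B then x * p else p) + (1 - p))"
    by (rule prod_add[OF fin, symmetric])
  also have "\<dots> = (\<Prod>e\<in>A. if e \<in> B then 1 - p + x * p else 1)" by (rule prod.cong) auto
  also have "\<dots> = (1 - p + x * p) ^ card B"
    using fin BA by (subst prod.inter_restrict[symmetric]) (auto simp: Int_absorb1)
  finally show ?thesis .
qed

lemma finite_all_pairs: "finite (all_pairs n)"
  by (rule finite_subset[of _ "Pow {0..<n}"]) (auto simp: all_pairs_def)

text \<open>The weight \<open>x\<close> is the parameter of an exponential Markov inequality for the number of edges
  inside \<open>W\<close>.\<close>

lemma prob_good_set_le:
  fixes p x :: real
  assumes p: "0 \<le> p" "p \<le> 1" and x: "0 < x" "x \<le> 1"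
  shows "prob_gnp n p (good_set TYPE(real^3) conn n k)
    \<le> real (n choose k) * (1 - p + x * p) ^ (k choose 2) / x ^ (130 * k)"
proof -
  let ?A = "all_pairs n" and ?B = "\<lambda>W. {e. e \<subseteq> W \<and> card e = 2}"
  let ?S = "{W. W \<subseteq> {0..<n} \<and> card W = k}"
  let ?w = "\<lambda>E. p ^ card E * (1 - p) ^ (card ?A - card E)"
  have finS: "finite ?S" by (rule finite_subset[of _ "Pow {0..<n}"]) auto
  have w: "?w E \<ge> 0" for E :: "nat set set" using p by simp
  have "prob_gnp n p (good_set TYPE(real^3) conn n k)
    \<le> (\<Sum>E\<in>Pow ?A. \<Sum>W\<in>?S. x ^ card (E \<inter> ?B W) * ?w E / x ^ (130 * k))"
    unfolding prob_gnp_def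
  proof (rule sum_mono)
    fix E assume "E \<in> Pow ?A"
    have nn: "0 \<le> x ^ card (E \<inter> ?B W) * ?w E / x ^ (130 * k)" for W using w x by simp
    show "(if good_set TYPE(real^3) conn n k E then ?w E else 0)
      \<le> (\<Sum>W\<in>?S. x ^ card (E \<inter> ?B W) * ?w E / x ^ (130 * k))"
    proof (cases "good_set TYPE(real^3) conn n k E")
      case True
      then obtain W where W: "W \<in> ?S" "is_diameter_graph TYPE(real^3) W E" unfolding good_set_def by blast
      then have "card (E \<inter> ?B W) \<le> 130 * k"
        using diameter_graph_edges_bound[of W E] finite_subset by fastforce
      \<comment> \<open>As \<open>x \<le> 1\<close>, few edges make the Markov weight of this
        \<open>W\<close> at least 1; the union bound then adds the other, nonnegative terms.\<close>
      then have "x ^ (130 * k) \<le> x ^ card (E \<inter> ?B W)" using x by (intro power_decreasing) auto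
      then have "1 * ?w E \<le> x ^ card (E \<inter> ?B W) / x ^ (130 * k) * ?w E"
        using x w by (intro mult_right_mono) auto
      also have "\<dots> = x ^ card (E \<inter> ?B W) * ?w E / x ^ (130 * k)" by simp
      also have "\<dots> \<le> (\<Sum>W\<in>?S. x ^ card (E \<inter> ?B W) * ?w E / x ^ (130 * k))"
        by (rule member_le_sum[OF W(1) _ finS]) (rule nn)
      finally show ?thesis using True by simp
    qed (simp add: sum_nonneg nn)
  qed
  also have "\<dots> = (\<Sum>W\<in>?S. (\<Sum>E\<in>Pow ?A. x ^ card (E \<inter> ?B W) * ?w E) / x ^ (130 * k))"
    by (subst sum.swap) (simp add: sum_divide_distrib)
  also have "\<dots> = (\<Sum>W\<in>?S. (1 - p + x * p) ^ (k choose 2) / x ^ (130 * k))"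
  proof (rule sum.cong)
    fix W assume W: "W \<in> ?S"
    then have "finite W" using finite_subset by blast
    then have "card (?B W) = k choose 2" using W by (simp add: n_subsets)
    moreover have "?B W \<subseteq> ?A"
    proof
      fix e assume "e \<in> ?B W"
      then have "e \<subseteq> W" "card e = 2" by auto
      then obtain u v where uv: "u \<noteq> v" "u \<in> W" "v \<in> W" "e = {u, v}" by (metis card_2_iff insert_subset)
      have "W \<subseteq> {0..<n}" using W by blast
      then have "u < n" "v < n" using uv(2,3) by auto
      then have "min u v < max u v" "max u v < n" using uv(1) by auto
      moreover have "e = {min u v, max u v}" using uv(4) by (auto simp: min_def max_def)
      ultimately show "e \<in> ?A" unfolding all_pairs_def by blast
    qed
    ultimately show "(\<Sum>E\<in>Pow ?A. x ^ card (E \<inter> ?B W) * ?w E) / x ^ (130 * k) =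
      (1 - p + x * p) ^ (k choose 2) / x ^ (130 * k)"
      using sum_Pow_power_weights[OF finite_all_pairs] by simp
  qed simp
  also have "\<dots> = real (n choose k) * (1 - p + x * p) ^ (k choose 2) / x ^ (130 * k)"
    by (simp add: n_subsets)
  finally show ?thesis .
qed

section \<open>Estimates for the first moment\<close>

lemma power_div_fact_le_exp:
  fixes x :: real
  assumes "0 \<le> x"
  shows "x ^ k / fact k \<le> exp x"
proof -
  have "(\<Sum>n\<in>{k}. x ^ n /\<^sub>R fact n) \<le> (\<Sum>n. x ^ n /\<^sub>R fact n)"
    by (rule sum_le_suminf) (use assms exp_converges[of x] in \<open>auto simp: sums_iff\<close>)
  then show ?thesis using exp_converges[of x] by (simp add: sums_iff divide_inverse mult.commute)
qed

text \<open>The standard bound \<open>(e * n / k) ^ k\<close>, written as an exponential so that all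
  factors can later be merged into one exponent.\<close>

lemma binomial_le_exp:
  assumes "0 < k" "0 < n"
  shows "real (n choose k) \<le> exp (real k * (ln (real n) + 1 - ln (real k)))"
proof -
  have "real (n choose k) * fact k \<le> real n ^ k"
    using binomial_fact_pow[of n k] by (metis of_nat_fact of_nat_le_iff of_nat_mult of_nat_power)
  then have "real (n choose k) \<le> real n ^ k / fact k" by (simp add: field_simps)
  also have "\<dots> = (real k ^ k / fact k) * (real n ^ k / real k ^ k)" using assms by simp
  also have "\<dots> \<le> exp (real k) * (real n ^ k / real k ^ k)"
    by (intro mult_right_mono power_div_fact_le_exp) auto
  also have "\<dots> = exp (real k * (ln (real n) + 1 - ln (real k)))"
    using assms by (simp add: algebra_simps exp_add exp_diff exp_of_nat_mult)
  finally show ?thesis .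
qed

text \<open>The choice \<open>x = (1 - p) / (p * k)\<close> in the Markov bound.\<close>

lemma prob_good_set_le_exp:
  fixes p :: real
  assumes p: "0 < p" "p < 1" and k: "0 < k" and n: "0 < n" and pk: "1 - p \<le> p * real k"
  shows "prob_gnp n p (good_set TYPE(real^3) conn n k)
    \<le> exp (real k * (ln (real n * p) + 129 * ln (p * real k) + 3/2
        + ln (1 - p) * real k / 2 - 131 * ln (1 - p)))"
proof -
  define q where "q = 1 - p"
  define x where "x = q / (p * real k)"
  have q: "0 < q" "q \<le> 1" using p q_def by auto
  have kp: "0 < p * real k" using p k by simp
  have x: "0 < x" "x \<le> 1" unfolding x_def using q kp pk q_def by (auto simp: divide_le_eq)
  have lnx: "ln x = ln q - ln (p * real k)" unfolding x_def by (rule ln_divide_pos[OF q(1) kp])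
  \<comment> \<open>For this \<open>x\<close> the base exceeds \<open>q\<close> only by the factor
    \<open>1 + 1 / k\<close>, which costs at most \<open>exp ((k - 1) / 2)\<close> over all
    pairs.\<close>
  have "1 - p + x * p = q * (1 + 1 / real k)" unfolding x_def q_def[symmetric] using p k by (simp add: field_simps)
  also have "\<dots> \<le> q * exp (1 / real k)" using q by (intro mult_left_mono) (auto simp: exp_ge_add_one_self)
  also have "\<dots> = exp (ln q + 1 / real k)" using q by (simp add: exp_add)
  finally have base: "1 - p + x * p \<le> exp (ln q + 1 / real k)" .
  have ch: "real (k choose 2) = real k * (real k - 1) / 2"
    using k by (cases k) (auto simp: choose_two real_of_nat_div algebra_simps)
  have "(1 - p + x * p) ^ (k choose 2) \<le> exp (ln q + 1 / real k) ^ (k choose 2)"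
    using base p x by (intro power_mono) auto
  also have "\<dots> = exp (real (k choose 2) * (ln q + 1 / real k))" by (rule exp_of_nat_mult[symmetric])
  also have "real (k choose 2) * (ln q + 1 / real k) = real k * ((real k - 1) / 2 * ln q) + (real k - 1) / 2"
    unfolding ch using k by (simp add: field_simps)
  also have "\<dots> \<le> real k * ((real k - 1) / 2 * ln q + 1/2)" by (simp add: algebra_simps)
  finally have B: "(1 - p + x * p) ^ (k choose 2) \<le> exp (real k * ((real k - 1) / 2 * ln q + 1/2))" by simp
  have "x ^ (130 * k) = exp (real (130 * k) * ln x)" using x(1) by (subst exp_of_nat_mult) simp
  then have X: "1 / x ^ (130 * k) = exp (real k * (130 * (ln (p * real k) - ln q)))"
    unfolding lnx by (simp add: exp_minus[symmetric] inverse_eq_divide[symmetric] algebra_simps)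
  have "prob_gnp n p (good_set TYPE(real^3) conn n k)
    \<le> real (n choose k) * (1 - p + x * p) ^ (k choose 2) * (1 / x ^ (130 * k))"
    using prob_good_set_le[of p x n conn k] p x by simp
  also have "\<dots> \<le> exp (real k * (ln (real n) + 1 - ln (real k))) * exp (real k * ((real k - 1) / 2 * ln q + 1/2))
      * exp (real k * (130 * (ln (p * real k) - ln q)))"
    unfolding X using binomial_le_exp[OF k n] B p x by (intro mult_mono) auto
  also have "\<dots> = exp (real k * ((ln (real n) + 1 - ln (real k)) + ((real k - 1) / 2 * ln q + 1/2)
      + 130 * (ln (p * real k) - ln q)))"
    by (simp only: exp_add[symmetric] distrib_left)
  also have "\<dots> \<le> exp (real k * (ln (real n * p) + 129 * ln (p * real k) + 3/2 + ln q * real k / 2 - 131 * ln q))"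
  proof -
    \<comment> \<open>Since \<open>ln n - ln k = ln (n * p) - ln (p * k)\<close>, one of the 130
      copies of \<open>ln (p * k)\<close> is used up. The \<open>130 + 1/2\<close> copies of
      \<open>- ln q\<close> are rounded up to 131, and \<open>3/2\<close> is
      \<open>1 + 1/2\<close>.\<close>
    have "ln (real n * p) = ln (real n) + ln p" "ln (p * real k) = ln p + ln (real k)"
      using n p k by (simp_all add: ln_mult)
    moreover have "ln q \<le> 0" using q by simp
    ultimately have "(ln (real n) + 1 - ln (real k)) + ((real k - 1) / 2 * ln q + 1/2) + 130 * (ln (p * real k) - ln q)
      \<le> ln (real n * p) + 129 * ln (p * real k) + 3/2 + ln q * real k / 2 - 131 * ln q"
      by (simp add: field_simps)
    then show ?thesis using k by simp
  qed
  finally show ?thesis unfolding q_def .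
qed

text \<open>Put \<open>y = k * ln (1 / (1 - p))\<close>. The assumption on \<open>k\<close> says
  \<open>ln (n * p) < y / (2 + \<epsilon>)\<close>, so the main terms add up to at most
  \<open>- \<gamma> * y\<close>. Everything else is logarithmic in \<open>y\<close>, so the
  threshold depends on \<open>\<epsilon>\<close> alone.\<close>

lemma prob_good_set_small:
  fixes \<epsilon> :: real
  assumes \<epsilon>: "\<epsilon> > 0"
  shows "\<exists>X0. \<forall>n p conn k. 0 < p \<longrightarrow> p < 1 \<longrightarrow> X0 \<le> real n * p \<longrightarrow> 1 \<le> (1 - p) * ln (real n) \<longrightarrow> 0 < k \<longrightarrow>
     (2 + \<epsilon>) * log (1 / (1 - p)) (real n * p) < real k \<longrightarrow>
     prob_gnp n p (good_set TYPE(real^3) conn n k) \<le> 1/2"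
proof -
  define \<gamma> where "\<gamma> = 1/2 - 1 / (2 + \<epsilon>)"
  have \<gamma>: "\<gamma> > 0" unfolding \<gamma>_def using \<epsilon> by (simp add: field_simps)
  \<comment> \<open>The constant is the \<open>3/2\<close> of the exponent plus 1; the extra 1
    leaves a final exponent of at most \<open>- k\<close>.\<close>
  have "eventually (\<lambda>y. 129 * ln y + 131 * ln (3 + y) + 5/2 - \<gamma> * y \<le> 0) at_top"
    using \<gamma> by real_asymp
  then obtain y0 where y0: "\<And>y. y \<ge> y0 \<Longrightarrow> 129 * ln y + 131 * ln (3 + y) + 5/2 - \<gamma> * y \<le> 0"
    by (auto simp: eventually_at_top_linorder)
  have main: "prob_gnp n p (good_set TYPE(real^3) conn n k) \<le> 1/2"
    if p: "0 < p" "p < 1" and X0: "exp (max y0 2) \<le> real n * p" and qn: "1 \<le> (1 - p) * ln (real n)"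
      and k: "0 < k" and big: "(2 + \<epsilon>) * log (1 / (1 - p)) (real n * p) < real k" for n p conn k
  proof -
    define L where "L = - ln (1 - p)"
    define y where "y = L * real k"
    define X where "X = real n * p"
    have X: "X > 0" using X0 exp_gt_zero[of "max y0 2"] unfolding X_def by linarith
    have n: "0 < n" using X unfolding X_def by (metis gr0I mult_zero_left of_nat_0 order_less_irrefl)
    have lnX: "max y0 2 \<le> ln X" using X0 ln_ge_iff[OF X] unfolding X_def by blast
    have pL: "p \<le> L" unfolding L_def using ln_le_minus_one[of "1 - p"] p by simp
    have L: "L > 0" using pL p by simp
    have "log (1 / (1 - p)) X = ln X / L" unfolding log_def L_def using p by (simp add: ln_div)
    then have "(2 + \<epsilon>) * ln X / L < real k" using big unfolding X_def by simp
    then have yX: "(2 + \<epsilon>) * ln X < y" unfolding y_def using L by (simp add: field_simps)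
    have "2 * ln X \<le> (2 + \<epsilon>) * ln X" using \<epsilon> lnX by (intro mult_right_mono) auto
    then have y: "y \<ge> 2" "y \<ge> y0" "ln X \<le> y" using yX lnX by linarith+
    \<comment> \<open>For \<open>p < 1/2\<close> one has \<open>L \<le> 2 * p\<close>, so
      \<open>y \<ge> 2\<close> gives \<open>p * k \<ge> 1\<close>.\<close>
    have pk: "1 - p \<le> p * real k"
    proof (cases "p \<ge> 1/2")
      case True
      have "p * 1 \<le> p * real k" using k p by (intro mult_left_mono) auto
      then show ?thesis using True by linarith
    next
      case False
      have "L = ln (1 / (1 - p))" unfolding L_def using p by (simp add: ln_div)
      also have "\<dots> \<le> 1 / (1 - p) - 1" using p by (intro ln_le_minus_one) auto
      also have "\<dots> = p / (1 - p)" using p by (simp add: field_simps)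
      also have "\<dots> \<le> p / (1/2)" using False p by (intro divide_left_mono) auto
      finally have "L * real k \<le> (2 * p) * real k" by (intro mult_right_mono) auto
      then show ?thesis using y(1) p unfolding y_def by linarith
    qed
    \<comment> \<open>For \<open>p \<ge> 1/2\<close> one has \<open>n \<le> 2 * X\<close>, so
      \<open>qn\<close> bounds \<open>1 / (1 - p)\<close> by \<open>ln 2 + ln X\<close>. This
      controls the factor \<open>1 / q\<close> when \<open>p\<close> is close to 1.\<close>
    have q3: "1 / (1 - p) \<le> 3 + y"
    proof (cases "p \<ge> 1/2")
      case True
      have "1 / (1 - p) \<le> ln (real n)" using qn p by (simp add: field_simps)
      also have "\<dots> \<le> ln (2 * X)" using True n unfolding X_def by simp
      also have "\<dots> = ln 2 + ln X" using X by (simp add: ln_mult)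
      also have "\<dots> \<le> 3 + y" using y(3) ln_le_minus_one[of 2] by simp
      finally show ?thesis .
    next
      case False
      then have "1 / (1 - p) \<le> 1 / (1/2)" using p by (intro divide_left_mono) auto
      then show ?thesis using y(1) by simp
    qed
    have L3: "L \<le> ln (3 + y)"
    proof -
      have "L = ln (1 / (1 - p))" unfolding L_def using p by (simp add: ln_div)
      also have "\<dots> \<le> ln (3 + y)" using q3 p y(1) by (subst ln_le_cancel_iff) auto
      finally show ?thesis .
    qed
    have "p * real k \<le> y" unfolding y_def using pL by (intro mult_right_mono) auto
    then have pky: "ln (p * real k) \<le> ln y" using p k y(1) by (subst ln_le_cancel_iff) auto
    have lX: "ln X \<le> y * (1 / (2 + \<epsilon>))" using yX \<epsilon> by (simp add: field_simps)
    have "ln X + 129 * ln (p * real k) + 3/2 + ln (1 - p) * real k / 2 - 131 * ln (1 - p)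
        = ln X + 129 * ln (p * real k) + 3/2 - y / 2 + 131 * L"
      unfolding y_def L_def by simp
    also have "\<dots> \<le> y * (1 / (2 + \<epsilon>)) + 129 * ln y + 3/2 - y / 2 + 131 * ln (3 + y)"
      using lX pky L3 by linarith
    also have "\<dots> = (129 * ln y + 131 * ln (3 + y) + 5/2 - \<gamma> * y) - 1"
      unfolding \<gamma>_def by (simp add: algebra_simps)
    also have "\<dots> \<le> -1" using y0[OF y(2)] by simp
    finally have ex: "ln X + 129 * ln (p * real k) + 3/2 + ln (1 - p) * real k / 2 - 131 * ln (1 - p) \<le> -1" .
    have "prob_gnp n p (good_set TYPE(real^3) conn n k)
      \<le> exp (real k * (ln X + 129 * ln (p * real k) + 3/2 + ln (1 - p) * real k / 2 - 131 * ln (1 - p)))"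
      unfolding X_def using prob_good_set_le_exp[OF p k n pk] by simp
    also have "\<dots> \<le> exp (real k * (-1))" using ex by (subst exp_le_cancel_iff, intro mult_left_mono) auto
    also have "\<dots> \<le> exp (-1)" using k by simp
    also have "\<dots> \<le> 1/2" using exp_ge_add_one_self[of 1] by (simp add: exp_minus field_simps)
    finally show ?thesis .
  qed
  show ?thesis by (intro exI[of _ "exp (max y0 2)"]) (use main in blast)
qed

section \<open>Bounds for \<open>u3\<close> and \<open>u3'\<close>\<close>

text \<open>No \<open>k > n\<close> has positive probability, so the \<open>GREATEST\<close> is
  attained and satisfies its own predicate. The condition \<open>0 \<le> B\<close> covers the
  default value 0.\<close>

lemma u_gen_le:
  assumes le: "\<And>k. 0 < k \<Longrightarrow> B < real k \<Longrightarrow> prob_gnp n p (good_set T conn n k) \<le> 1/2" and B: "0 \<le> B"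
  shows "real (u_gen T conn n p) \<le> B"
proof (cases "\<exists>k. 0 < k \<and> prob_gnp n p (good_set T conn n k) > 1/2")
  case True
  let ?P = "\<lambda>k. 0 < k \<and> prob_gnp n p (good_set T conn n k) > 1/2"
  have bd: "k \<le> n" if "?P k" for k
  proof (rule ccontr)
    assume "\<not> k \<le> n"
    then have "\<not> good_set T conn n k E" for E
      unfolding good_set_def using card_mono[of "{0..<n}"] by fastforce
    then have "prob_gnp n p (good_set T conn n k) = 0" unfolding prob_gnp_def by simp
    then show False using that by simp
  qed
  have "?P (GREATEST k. ?P k)" using GreatestI_ex_nat[of ?P n] True bd by blast
  then have "?P (u_gen T conn n p)" unfolding u_gen_def using True by simp
  then show ?thesis using le[of "u_gen T conn n p"] by force
next
  case False
  then show ?thesis unfolding u_gen_def using B by (simp only: if_False of_nat_0)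
qed

theorem theorem21:
  fixes p :: "nat \<Rightarrow> real"
  assumes "\<forall>n. 0 \<le> p n \<and> p n \<le> 1"
    and "filterlim (\<lambda>n. real n * p n) at_top sequentially"
    and "filterlim (\<lambda>n. (1 - p n) * ln (real n)) at_top sequentially"
  shows "\<forall>\<epsilon>>0. \<exists>n0. \<forall>n\<ge>n0.
           real (u3 n (p n)) \<le> (2 + \<epsilon>) * log (1 / (1 - p n)) (real n * p n) \<and>
           real (u3' n (p n)) \<le> (2 + \<epsilon>) * log (1 / (1 - p n)) (real n * p n)"
proof (intro allI impI)
  fix \<epsilon> :: real assume \<epsilon>: "\<epsilon> > 0"
  obtain X0 where X0: "\<And>n p conn k. 0 < p \<Longrightarrow> p < 1 \<Longrightarrow> X0 \<le> real n * p \<Longrightarrow> 1 \<le> (1 - p) * ln (real n) \<Longrightarrow> 0 < k \<Longrightarrow>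
     (2 + \<epsilon>) * log (1 / (1 - p)) (real n * p) < real k \<Longrightarrow>
     prob_gnp n p (good_set TYPE(real^3) conn n k) \<le> 1/2"
    using prob_good_set_small[OF \<epsilon>] by blast
  \<comment> \<open>The 1 in \<open>max X0 1\<close> makes the logarithm nonnegative and excludes
    \<open>p n = 0\<close>; the second condition excludes \<open>p n = 1\<close>.\<close>
  have "eventually (\<lambda>n. max X0 1 \<le> real n * p n \<and> 1 \<le> (1 - p n) * ln (real n)) sequentially"
    using assms(2,3) unfolding filterlim_at_top by (intro eventually_conj) blast+
  then obtain n0 where n0: "\<And>n. n \<ge> n0 \<Longrightarrow> max X0 1 \<le> real n * p n \<and> 1 \<le> (1 - p n) * ln (real n)"
    by (auto simp: eventually_sequentially)
  have "real (u_gen TYPE(real^3) conn n (p n)) \<le> (2 + \<epsilon>) * log (1 / (1 - p n)) (real n * p n)"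
    if "n \<ge> n0" for n conn
  proof (rule u_gen_le)
    have *: "X0 \<le> real n * p n" "1 \<le> real n * p n" "1 \<le> (1 - p n) * ln (real n)" using n0[OF that] by auto
    have "p n \<noteq> 0" "p n \<noteq> 1" using * by auto
    then have p: "0 < p n" "p n < 1" using assms(1) by (auto simp: order_less_le)
    show "prob_gnp n (p n) (good_set TYPE(real^3) conn n k) \<le> 1/2"
      if "0 < k" "(2 + \<epsilon>) * log (1 / (1 - p n)) (real n * p n) < real k" for k
      using X0 p * that by blast
    have "0 \<le> log (1 / (1 - p n)) (real n * p n)"
      unfolding log_def using p *(2) by (intro divide_nonneg_nonneg ln_ge_zero) (auto simp: field_simps)
    then show "0 \<le> (2 + \<epsilon>) * log (1 / (1 - p n)) (real n * p n)" using \<epsilon> by simp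
  qed
  then show "\<exists>n0. \<forall>n\<ge>n0.
           real (u3 n (p n)) \<le> (2 + \<epsilon>) * log (1 / (1 - p n)) (real n * p n) \<and>
           real (u3' n (p n)) \<le> (2 + \<epsilon>) * log (1 / (1 - p n)) (real n * p n)"
    unfolding u3_def u3'_def by blast
qed

end
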